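(* Let $(\mathcal X_n,\mathcal X_n^\Omega)$, $n\in\mathbb N$, be a sequence of countably separated quasi-universal spaces and $(\mathcal Z,\mathcal Z^\Omega)$ a standard quasi-universal space. Put $\mathcal X_{0:n}:=\prod_{k=0}^n\mathcal X_k$ and $\mathcal X_{\mathbb N}:=\prod_{n\in\mathbb N}\mathcal X_n$ (products of quasi-universal spaces), and let $\mathrm{pr}_{0:n}$ denote the canonical projections onto $\mathcal X_{0:n}$. Assume that for every $n\in\mathbb N$ we have $Q_n(X_{0:n}|Z)\in\mathsf P(\mathcal X_{0:n})^{\mathcal Z}$ such that for every $n\in\mathbb N$ $$\mathrm{pr}_{0:n,*}Q_{n+1}(X_{0:n+1}|Z)=Q_n(X_{0:n}|Z).$$ Then there exists a unique $Q(X_{\mathbb N}|Z)\in\mathsf P(\mathcal X_{\mathbb N})^{\mathcal Z}$ such that for every $n\in\mathbb N$ $$\mathrm{pr}_{0:n,*}Q(X_{\mathbb N}|Z)=Q_n(X_{0:n}|Z).$$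
   Context: Fix the sample space: $\Omega=[0,1]^{\mathbb N}$, $\mathcal B_\Omega$ the $\sigma$-algebra of all universally measurable subsets of $\Omega$, $\Omega^\Omega$ the set of all measurable maps $(\Omega,\mathcal B_\Omega)\to(\Omega,\mathcal B_\Omega)$. A quasi-universal space is a pair $(\mathcal X,\mathcal X^\Omega)$ of a set and a set $\mathcal X^\Omega$ of maps $\Omega\to\mathcal X$ (admissible random variables) containing all constants and closed under $X\mapsto X\circ\Phi$, $\Phi\in\Omega^\Omega$; $g:\mathcal X\to\mathcal Y$ is quasi-measurable if $g\circ\mathcal X^\Omega\subseteq\mathcal Y^\Omega$; arbitrary products carry the componentwise structure $\prod_i\mathcal X_i^\Omega$. For spaces $\mathcal X,\mathcal Z$, $\mathcal X^{\mathcal Z}$ is the set of quasi-measurable maps $\mathcal Z\to\mathcal X$, and $(\mathcal X^\Omega)^\Omega$ is the set of maps $X:\Omega\to\mathcal X^\Omega$ with $(\omega,\omega')\mapsto X(\omega)(\omega')$ quasi-measurable $\Omega\times\Omega\to\mathcal X$. The induced $\sigma$-algebra is $\mathcal B_{\mathcal X}=\{A\subseteq\mathcal X\mid X^{-1}(A)\in\mathcal B_\Omega\ \forall X\in\mathcal X^\Omega\}$. A quasi-universal space is countably separated if some countable subset of $\mathcal B_{\mathcal X}$ separates the points of $\mathcal X$; it is standard if it is empty or a retract of $(\Omega,\Omega^\Omega)$, i.e. there are quasi-measurable $i:\mathcal X\to\Omega$, $r:\Omega\to\mathcal X$ with $r\circ i=\mathrm{id}$. $\mathsf P(\mathcal X)$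 is the quasi-universal space of push-forward measures $X_*P$ on $\mathcal B_{\mathcal X}$, with $X\in\mathcal X^\Omega$ and $P$ a probability measure on $(\Omega,\mathcal B_\Omega)$; its admissible random variables are the maps $\omega\mapsto X(\omega)_*P$ with $X\in(\mathcal X^\Omega)^\Omega$, $P$ a probability measure on $(\Omega,\mathcal B_\Omega)$. *)

theory Defs
  imports "HOL-Probability.Probability"
begin

section \<open>The sample space\<close>

typedef omega = "{w :: nat \<Rightarrow> real. \<forall>n. w n \<in> {0..1}}"
  by (rule exI[of _ "\<lambda>_. 0"]) simp

text \<open>The topology of \<^typ>\<open>omega\<close> is the subspace topology inherited from the product
  topology on \<^typ>\<open>nat \<Rightarrow> real\<close>.\<close>

instantiation omega :: topological_space
begin

definition open_omega :: "omega set \<Rightarrow> bool" where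
  "open_omega U \<longleftrightarrow> (\<exists>V. open V \<and> U = Rep_omega -` V)"

instance
proof
  show "open (UNIV :: omega set)"
    unfolding open_omega_def by (rule exI[of _ UNIV]) simp
next
  fix S T :: "omega set"
  assume "open S" "open T"
  then obtain V W where "open V" "S = Rep_omega -` V" "open W" "T = Rep_omega -` W"
    unfolding open_omega_def by blast
  then show "open (S \<inter> T)"
    unfolding open_omega_def by (intro exI[of _ "V \<inter> W"]) auto
next
  fix K :: "omega set set"
  assume "\<forall>S\<in>K. open S"
  then obtain V where V: "\<And>S. S \<in> K \<Longrightarrow> open (V S) \<and> S = Rep_omega -` V S"
    unfolding open_omega_def by metis
  have "\<Union>K = (\<Union>S\<in>K. Rep_omega -` V S)"
    using V by auto
  also have "\<dots> = Rep_omega -` (\<Union>S\<in>K. V S)"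
    by blast
  finally show "open (\<Union>K)"
    unfolding open_omega_def using V by (intro exI[of _ "\<Union>S\<in>K. V S"]) auto
qed

end

definition universally_measurable_sets :: "'a::topological_space set set" where
  "universally_measurable_sets =
     {A. \<forall>M. prob_space M \<and> sets M = sets (borel :: 'a measure) \<longrightarrow> A \<in> sets (completion M)}"

definition B_Omega :: "omega measure" where
  "B_Omega = sigma UNIV universally_measurable_sets"

lemma sigma_algebra_universally_measurable:
  "sigma_algebra (UNIV :: 'a::topological_space set) universally_measurable_sets"
proof -
  have *: "A \<in> universally_measurable_sets \<longleftrightarrow>
      (\<forall>M \<in> {M. prob_space M \<and> sets M = sets (borel :: 'a measure)}. A \<in> sets (completion M))"
    for A :: "'a set"
    by (auto simp: universally_measurable_sets_def)
  have sp: "space (completion M) = UNIV"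
    if "M \<in> {M. prob_space M \<and> sets M = sets (borel :: 'a measure)}" for M
    using that sets_eq_imp_space_eq[of M "borel :: 'a measure"] by simp
  show ?thesis
    unfolding sigma_algebra_iff2
  proof (intro conjI ballI allI impI)
    show "({} :: 'a set) \<in> universally_measurable_sets"
      unfolding * by (intro ballI sets.empty_sets)
  next
    fix A :: "'a set"
    assume "A \<in> universally_measurable_sets"
    then show "UNIV - A \<in> universally_measurable_sets"
      unfolding * using sp by (metis sets.compl_sets)
  next
    fix A :: "nat \<Rightarrow> 'a set"
    assume "range A \<subseteq> universally_measurable_sets"
    then have "A i \<in> universally_measurable_sets" for i
      by blast
    then show "(\<Union>i. A i) \<in> universally_measurable_sets"
      unfolding * by (intro ballI sets.countable_UN) auto
  qed simp
qed

lemma space_B_Omega [simp]: "space B_Omega = UNIV"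
  by (simp add: B_Omega_def)

lemma sets_B_Omega: "sets B_Omega = universally_measurable_sets"
  unfolding B_Omega_def
  by (simp add: sigma_algebra.sigma_sets_eq[OF sigma_algebra_universally_measurable])


section \<open>Quasi-universal spaces\<close>

text \<open>The field \<open>rvs\<close> is the set of admissible random variables.\<close>

record 'a qspace =
  points :: "'a set"
  rvs :: "(omega \<Rightarrow> 'a) set"

definition quasi_universal :: "'a qspace \<Rightarrow> bool" where
  "quasi_universal X \<longleftrightarrow>
     (\<forall>\<xi>\<in>rvs X. range \<xi> \<subseteq> points X) \<and>
     (\<forall>x\<in>points X. (\<lambda>_. x) \<in> rvs X) \<and>
     (\<forall>\<xi>\<in>rvs X. \<forall>\<phi>\<in>B_Omega \<rightarrow>\<^sub>M B_Omega. \<xi> \<circ> \<phi> \<in> rvs X)"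

definition quasi_measurable :: "'a qspace \<Rightarrow> 'b qspace \<Rightarrow> ('a \<Rightarrow> 'b) \<Rightarrow> bool" where
  "quasi_measurable X Y g \<longleftrightarrow>
     g \<in> points X \<rightarrow> points Y \<and> (\<forall>\<xi>\<in>rvs X. g \<circ> \<xi> \<in> rvs Y)"

definition Omega :: "omega qspace" where
  "Omega = \<lparr>points = UNIV, rvs = B_Omega \<rightarrow>\<^sub>M B_Omega\<rparr>"

definition pair_qspace :: "'a qspace \<Rightarrow> 'b qspace \<Rightarrow> ('a \<times> 'b) qspace" where
  "pair_qspace X Y =
     \<lparr>points = points X \<times> points Y, rvs = {\<xi>. fst \<circ> \<xi> \<in> rvs X \<and> snd \<circ> \<xi> \<in> rvs Y}\<rparr>"

definition prod_qspace :: "'i set \<Rightarrow> ('i \<Rightarrow> 'a qspace) \<Rightarrow> ('i \<Rightarrow> 'a) qspace" where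
  "prod_qspace I X =
     \<lparr>points = (\<Pi>\<^sub>E i\<in>I. points (X i)),
      rvs = {\<xi>. range \<xi> \<subseteq> extensional I \<and> (\<forall>i\<in>I. (\<lambda>\<omega>. \<xi> \<omega> i) \<in> rvs (X i))}\<rparr>"

text \<open>The set $X^Z$; its elements are made extensional on \<^term>\<open>points Z\<close>, so that equality
  in it is equality of maps $Z \to X$.\<close>

definition qmaps :: "'z qspace \<Rightarrow> 'a qspace \<Rightarrow> ('z \<Rightarrow> 'a) set" where
  "qmaps Z X = {g. quasi_measurable Z X g} \<inter> extensional (points Z)"

definition rv_qspace :: "'a qspace \<Rightarrow> (omega \<Rightarrow> 'a) qspace" where
  "rv_qspace X =
     \<lparr>points = rvs X,
      rvs = {\<Xi>. range \<Xi> \<subseteq> rvs X \<and>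
               quasi_measurable (pair_qspace Omega Omega) X (\<lambda>(\<omega>, \<omega>'). \<Xi> \<omega> \<omega>')}\<rparr>"

definition induced_sets :: "'a qspace \<Rightarrow> 'a set set" where
  "induced_sets X = {A. A \<subseteq> points X \<and> (\<forall>\<xi>\<in>rvs X. \<xi> -` A \<in> sets B_Omega)}"

text \<open>Only the space and the \<open>\<sigma>\<close>-algebra of \<open>qsigma X\<close> matter; its measure is the zero measure.\<close>

definition qsigma :: "'a qspace \<Rightarrow> 'a measure" where
  "qsigma X = sigma (points X) (induced_sets X)"

definition countably_separated :: "'a qspace \<Rightarrow> bool" where
  "countably_separated X \<longleftrightarrow>
     (\<exists>C. countable C \<and> C \<subseteq> induced_sets X \<and>
       (\<forall>x\<in>points X. \<forall>y\<in>points X. x \<noteq> y \<longrightarrow> (\<exists>A\<in>C. (x \<in> A) \<noteq> (y \<in> A))))"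

definition standard_qspace :: "'a qspace \<Rightarrow> bool" where
  "standard_qspace X \<longleftrightarrow>
     points X = {} \<or>
     (\<exists>i r. quasi_measurable X Omega i \<and> quasi_measurable Omega X r \<and>
       (\<forall>x\<in>points X. r (i x) = x))"

definition omega_probs :: "omega measure set" where
  "omega_probs = {P. prob_space P \<and> sets P = sets B_Omega}"

definition prob_qspace :: "'a qspace \<Rightarrow> 'a measure qspace" where
  "prob_qspace X =
     \<lparr>points = {distr P (qsigma X) \<xi> | \<xi> P. \<xi> \<in> rvs X \<and> P \<in> omega_probs},
      rvs = {(\<lambda>\<omega>. distr P (qsigma X) (\<Xi> \<omega>)) | \<Xi> P.
               \<Xi> \<in> rvs (rv_qspace X) \<and> P \<in> omega_probs}\<rparr>"


section \<open>Basic facts\<close>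

lemma sigma_algebra_induced_sets:
  assumes "quasi_universal X"
  shows "sigma_algebra (points X) (induced_sets X)"
  unfolding sigma_algebra_iff2
proof (intro conjI ballI allI impI)
  show "induced_sets X \<subseteq> Pow (points X)" "{} \<in> induced_sets X"
    by (auto simp: induced_sets_def)
next
  fix A assume A: "A \<in> induced_sets X"
  have "\<xi> -` (points X - A) \<in> sets B_Omega" if "\<xi> \<in> rvs X" for \<xi>
  proof -
    have "\<xi> -` (points X - A) = space B_Omega - \<xi> -` A"
      using assms that by (auto simp: quasi_universal_def image_subset_iff)
    moreover have "\<xi> -` A \<in> sets B_Omega"
      using A that by (simp add: induced_sets_def)
    ultimately show ?thesis
      by (metis sets.compl_sets)
  qed
  then show "points X - A \<in> induced_sets X"
    by (auto simp: induced_sets_def)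
next
  fix A :: "nat \<Rightarrow> _" assume "range A \<subseteq> induced_sets X"
  then show "(\<Union>i. A i) \<in> induced_sets X"
    by (auto simp: induced_sets_def vimage_UN image_subset_iff)
qed

lemma space_qsigma [simp]: "space (qsigma X) = points X"
  by (simp add: qsigma_def space_measure_of_conv)

lemma sets_qsigma: "quasi_universal X \<Longrightarrow> sets (qsigma X) = induced_sets X"
  unfolding qsigma_def
  by (subst sets_measure_of)
     (auto simp: induced_sets_def[of X]
       sigma_algebra.sigma_sets_eq[OF sigma_algebra_induced_sets, unfolded induced_sets_def])

lemma rvs_measurable:
  assumes "quasi_universal X" "\<xi> \<in> rvs X"
  shows "\<xi> \<in> B_Omega \<rightarrow>\<^sub>M qsigma X"
  using assms by (auto simp: measurable_def sets_qsigma induced_sets_def quasi_universal_def)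

lemma quasi_measurable_measurable:
  assumes X: "quasi_universal X" and Y: "quasi_universal Y" and g: "quasi_measurable X Y g"
  shows "g \<in> qsigma X \<rightarrow>\<^sub>M qsigma Y"
proof (rule measurableI)
  show "g x \<in> space (qsigma Y)" if "x \<in> space (qsigma X)" for x
    using g that by (auto simp: quasi_measurable_def)
next
  fix A assume "A \<in> sets (qsigma Y)"
  then have A: "A \<in> induced_sets Y"
    by (simp add: sets_qsigma Y)
  have "\<xi> -` (g -` A \<inter> points X) \<in> sets B_Omega" if "\<xi> \<in> rvs X" for \<xi>
  proof -
    have "\<xi> -` (g -` A \<inter> points X) = (g \<circ> \<xi>) -` A"
      using X that by (auto simp: quasi_universal_def image_subset_iff)
    then show ?thesis
      using A g that by (auto simp: induced_sets_def quasi_measurable_def)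
  qed
  then show "g -` A \<inter> space (qsigma X) \<in> sets (qsigma X)"
    by (auto simp: sets_qsigma X induced_sets_def)
qed

lemma quasi_universal_Omega: "quasi_universal Omega"
  by (auto simp: quasi_universal_def Omega_def intro: measurable_comp)

lemma quasi_universal_pair:
  "quasi_universal X \<Longrightarrow> quasi_universal Y \<Longrightarrow> quasi_universal (pair_qspace X Y)"
  by (fastforce simp: quasi_universal_def pair_qspace_def comp_assoc[symmetric] image_subset_iff
      mem_Times_iff comp_def)

lemma quasi_universal_prod:
  assumes "\<And>i. i \<in> I \<Longrightarrow> quasi_universal (X i)"
  shows "quasi_universal (prod_qspace I X)"
  using assms
  by (fastforce simp: quasi_universal_def prod_qspace_def image_subset_iff PiE_iff comp_def)

lemma quasi_universal_rv:
  assumes X: "quasi_universal X"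
  shows "quasi_universal (rv_qspace X)"
  unfolding quasi_universal_def
proof (intro conjI ballI)
  show "range \<Xi> \<subseteq> points (rv_qspace X)" if "\<Xi> \<in> rvs (rv_qspace X)" for \<Xi>
    using that by (auto simp: rv_qspace_def)
next
  fix \<xi> assume "\<xi> \<in> points (rv_qspace X)"
  then have \<xi>: "\<xi> \<in> rvs X"
    by (simp add: rv_qspace_def)
  then have "\<xi> \<circ> (snd \<circ> \<psi>) \<in> rvs X" if "snd \<circ> \<psi> \<in> B_Omega \<rightarrow>\<^sub>M B_Omega"
    for \<psi> :: "omega \<Rightarrow> omega \<times> omega"
    using X that by (auto simp: quasi_universal_def)
  then show "(\<lambda>_. \<xi>) \<in> rvs (rv_qspace X)"
    using X \<xi> by (auto simp: rv_qspace_def quasi_measurable_def quasi_universal_def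
        image_subset_iff pair_qspace_def Omega_def comp_def case_prod_unfold)
next
  fix \<Xi> and \<phi> :: "omega \<Rightarrow> omega"
  assume \<Xi>: "\<Xi> \<in> rvs (rv_qspace X)" and \<phi>: "\<phi> \<in> B_Omega \<rightarrow>\<^sub>M B_Omega"
  let ?g = "\<lambda>(\<omega>, \<omega>'). \<Xi> \<omega> \<omega>'"
  have "(\<lambda>(\<omega>, \<omega>'). (\<Xi> \<circ> \<phi>) \<omega> \<omega>') \<circ> \<psi> \<in> rvs X"
    if \<psi>: "\<psi> \<in> rvs (pair_qspace Omega Omega)" for \<psi>
  proof -
    have "(\<lambda>x. (\<phi> (fst (\<psi> x)), snd (\<psi> x))) \<in> rvs (pair_qspace Omega Omega)"
      using \<psi> measurable_comp[of "fst \<circ> \<psi>" B_Omega B_Omega \<phi> B_Omega] \<phi>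
      by (auto simp: pair_qspace_def Omega_def comp_def)
    then have "?g \<circ> (\<lambda>x. (\<phi> (fst (\<psi> x)), snd (\<psi> x))) \<in> rvs X"
      using \<Xi> by (auto simp: rv_qspace_def quasi_measurable_def)
    then show ?thesis
      by (simp add: comp_def case_prod_unfold)
  qed
  moreover have "range (\<Xi> \<circ> \<phi>) \<subseteq> rvs X"
    using \<Xi> by (auto simp: rv_qspace_def)
  moreover from this have "(\<lambda>(\<omega>, \<omega>'). (\<Xi> \<circ> \<phi>) \<omega> \<omega>')
      \<in> points (pair_qspace Omega Omega) \<rightarrow> points X"
    using X by (auto simp: quasi_universal_def image_subset_iff)
  ultimately show "\<Xi> \<circ> \<phi> \<in> rvs (rv_qspace X)"
    unfolding rv_qspace_def quasi_measurable_def qspace.simps by blast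
qed

lemma quasi_universal_prob:
  assumes X: "quasi_universal X"
  shows "quasi_universal (prob_qspace X)"
  unfolding quasi_universal_def
proof (intro conjI ballI)
  show "range \<kappa> \<subseteq> points (prob_qspace X)" if "\<kappa> \<in> rvs (prob_qspace X)" for \<kappa>
    using that by (fastforce simp: prob_qspace_def rv_qspace_def)
next
  fix \<mu> assume "\<mu> \<in> points (prob_qspace X)"
  then obtain \<xi> P where *: "\<mu> = distr P (qsigma X) \<xi>" "\<xi> \<in> rvs X" "P \<in> omega_probs"
    by (auto simp: prob_qspace_def)
  then have "(\<lambda>_. \<xi>) \<in> rvs (rv_qspace X)"
    using quasi_universal_rv[OF X] by (auto simp: quasi_universal_def rv_qspace_def)
  then show "(\<lambda>_. \<mu>) \<in> rvs (prob_qspace X)"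
    using * unfolding prob_qspace_def
    by (simp, intro exI[of _ "\<lambda>_. \<xi>"] exI[of _ P]) auto
next
  fix \<kappa> and \<phi> :: "omega \<Rightarrow> omega"
  assume "\<kappa> \<in> rvs (prob_qspace X)" and \<phi>: "\<phi> \<in> B_Omega \<rightarrow>\<^sub>M B_Omega"
  then obtain \<Xi> P where
    *: "\<kappa> = (\<lambda>\<omega>. distr P (qsigma X) (\<Xi> \<omega>))" "\<Xi> \<in> rvs (rv_qspace X)" "P \<in> omega_probs"
    by (auto simp: prob_qspace_def)
  then have "\<Xi> \<circ> \<phi> \<in> rvs (rv_qspace X)"
    using quasi_universal_rv[OF X] \<phi> by (auto simp: quasi_universal_def)
  then show "\<kappa> \<circ> \<phi> \<in> rvs (prob_qspace X)"
    using * unfolding prob_qspace_def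
    by (simp, intro exI[of _ "\<Xi> \<circ> \<phi>"] exI[of _ P]) (auto simp: comp_def)
qed

lemma sets_prob_qspace: "\<mu> \<in> points (prob_qspace X) \<Longrightarrow> sets \<mu> = sets (qsigma X)"
  by (auto simp: prob_qspace_def)

end

theory Submission
  imports Defs
begin

text \<open>Write \<open>Q\<^sub>n(z)\<close> as the law of \<open>\<Xi>\<^sub>n(z, \<omega>)\<close> with \<open>\<omega>\<close> distributed as \<open>P\<^sub>n\<close>. The spaces \<open>X\<^sub>n\<close> need not
  be standard, so points of \<open>X\<^sub>0\<^sub>:\<^sub>n\<close> cannot be recovered measurably from their images under a
  separating sequence of sets. What can be recovered is the source of randomness: a sampler \<open>k\<^sub>n\<close>
  draws \<open>\<omega>\<close> from its conditional law given \<open>z\<close> and the bits that separate the coordinates below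
  \<open>n\<close>, using one extra uniform variable. Drawing \<open>\<omega>\<^sub>n\<close> in this way from
  \<open>x\<^sub>0, \<dots>, x\<^sub>n\<^sub>-\<^sub>1\<close> and putting \<open>x\<^sub>n\<close> equal to the last coordinate of
  \<open>\<Xi>\<^sub>n(z, \<omega>\<^sub>n)\<close>, one finds that \<open>\<Xi>\<^sub>n(z, \<omega>\<^sub>n)\<close> has the same separating bits as the old
  coordinates, hence almost surely restricts to them, and that \<open>\<omega>\<^sub>n\<close> has law \<open>P\<^sub>n\<close>; so
  \<open>x\<^sub>0\<^sub>:\<^sub>n\<close> has law \<open>Q\<^sub>n(z)\<close>. All \<open>x\<^sub>n\<close> are functions of \<open>z\<close> and one sequence of independent
  uniform variables, which is a point of the sample space. The same sampler couples two laws on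
  the infinite product with equal finite marginals so that the sampled points agree almost surely.
  This gives uniqueness on the whole induced \<open>\<sigma>\<close>-algebra, which may be larger than the product
  \<open>\<sigma>\<close>-algebra.\<close>

section \<open>Measures on bit sequences\<close>

abbreviation bits :: "(nat \<Rightarrow> bool) measure" where
  "bits \<equiv> PiM UNIV (\<lambda>_. count_space UNIV)"

definition pref :: "nat \<Rightarrow> (nat \<Rightarrow> bool) \<Rightarrow> bool list" where
  "pref m y = map y [0..<m]"

definition cyl :: "bool list \<Rightarrow> (nat \<Rightarrow> bool) set" where
  "cyl s = {y. pref (length s) y = s}"

lemma length_pref [simp]: "length (pref m y) = m"
  by (simp add: pref_def)

lemma take_pref: "m \<le> n \<Longrightarrow> take m (pref n y) = pref m y"
  by (simp add: pref_def take_map)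

lemma pref_Suc: "pref (Suc m) y = pref m y @ [y m]"
  by (simp add: pref_def)

lemma nth_pref: "i < m \<Longrightarrow> pref m y ! i = y i"
  by (simp add: pref_def)

lemma space_bits [simp]: "space bits = UNIV"
  by (simp add: space_PiM PiE_def)

lemma measurable_bits_iff:
  "f \<in> M \<rightarrow>\<^sub>M bits \<longleftrightarrow> (\<forall>i. Measurable.pred M (\<lambda>x. f x i))"
proof
  assume "f \<in> M \<rightarrow>\<^sub>M bits"
  then show "\<forall>i. Measurable.pred M (\<lambda>x. f x i)"
    by (auto intro: measurable_compose[OF _ measurable_component_singleton])
next
  assume "\<forall>i. Measurable.pred M (\<lambda>x. f x i)"
  then show "f \<in> M \<rightarrow>\<^sub>M bits"
    by (intro measurable_PiM_single') (auto simp: PiE_def)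
qed

lemma measurable_bit [measurable]: "(\<lambda>y. y i) \<in> bits \<rightarrow>\<^sub>M count_space UNIV"
  by (rule measurable_component_singleton) simp

lemma measurable_pref [measurable]: "pref m \<in> bits \<rightarrow>\<^sub>M count_space UNIV"
proof (induction m)
  case 0
  then show ?case by (simp add: pref_def)
next
  case (Suc m)
  note [measurable] = Suc
  show ?case unfolding pref_Suc by measurable
qed

lemma sets_cyl [measurable]: "cyl s \<in> sets bits"
proof -
  have "cyl s = pref (length s) -` {s} \<inter> space bits"
    by (auto simp: cyl_def)
  then show ?thesis
    by (metis measurable_pref measurable_sets sets_count_space Pow_iff subset_UNIV)
qed

lemma finite_lists_length: "finite {s :: bool list. length s = m}"
  using finite_lists_length_eq[of "UNIV :: bool set" m] by simp

text \<open>Two cylinders are nested or disjoint, depending on whether the shorter word is a prefix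
  of the longer. With the empty set added they form an intersection-stable family, and it generates
  because bit \<open>i\<close> can be read off the prefix of length \<open>Suc i\<close>.\<close>

lemma bits_measure_eqI:
  assumes \<mu>: "finite_measure \<mu>" "sets \<mu> = sets bits" and \<nu>: "sets \<nu> = sets bits"
    and eq: "\<And>s. emeasure \<mu> (cyl s) = emeasure \<nu> (cyl s)"
  shows "\<mu> = \<nu>"
proof (rule measure_eqI_generator_eq[where \<Omega> = UNIV and E = "insert {} (range cyl)" and A = "\<lambda>_. cyl []"])
  let ?E = "insert {} (range cyl)"
  show "Int_stable ?E"
  proof (rule Int_stableI)
    have *: "cyl s \<inter> cyl t \<in> ?E" if "length s \<le> length t" for s t
    proof (cases "take (length s) t = s")
      case True
      have "pref (length s) y = s" if "pref (length t) y = t" for y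
        using True take_pref[OF \<open>length s \<le> length t\<close>, of y] that by simp
      then have "cyl s \<inter> cyl t = cyl t"
        by (auto simp: cyl_def)
      then show ?thesis by simp
    next
      case False
      have "False" if "y \<in> cyl s" "y \<in> cyl t" for y
        using False take_pref[OF \<open>length s \<le> length t\<close>, of y] that by (simp add: cyl_def)
      then have "cyl s \<inter> cyl t = {}"
        by blast
      then show ?thesis by simp
    qed
    have **: "cyl s \<inter> cyl t \<in> ?E" for s t
      using *[of s t] *[of t s] by (cases "length s \<le> length t") (auto simp only: Int_commute nle_le)
    fix a b assume "a \<in> ?E" "b \<in> ?E"
    then consider "a \<inter> b = {}" | s t where "a = cyl s" "b = cyl t"
      by blast
    then show "a \<inter> b \<in> ?E"
      using ** by cases simp_all
  qed
  have "sets bits = sigma_sets UNIV ?E"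
  proof
    have "(\<lambda>y. y i) \<in> sigma UNIV ?E \<rightarrow>\<^sub>M count_space UNIV" for i :: nat
    proof -
      have "pref (Suc i) \<in> sigma UNIV ?E \<rightarrow>\<^sub>M count_space UNIV"
      proof (rule measurable_count_space_eq2_countable[THEN iffD2])
        have "pref (Suc i) -` {s} \<in> sigma_sets UNIV ?E" for s
        proof (cases "length s = Suc i")
          case True
          then have "pref (Suc i) -` {s} = cyl s" by (auto simp: cyl_def)
          then show ?thesis by (auto intro: sigma_sets.Basic)
        next
          case False
          then have "pref (Suc i) -` {s} = {}" by (metis length_pref vimage_singleton_eq equals0I)
          then show ?thesis by (simp add: sigma_sets.Empty)
        qed
        then show "pref (Suc i) \<in> space (sigma UNIV ?E) \<rightarrow> UNIV \<and>
          (\<forall>a\<in>UNIV. pref (Suc i) -` {a} \<inter> space (sigma UNIV ?E) \<in> sets (sigma UNIV ?E))"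
          by simp
      qed
      then have "(\<lambda>y. pref (Suc i) y ! i) \<in> sigma UNIV ?E \<rightarrow>\<^sub>M count_space UNIV"
        by (rule measurable_compose) simp
      then show ?thesis
        by (simp add: nth_pref)
    qed
    then have "id \<in> sigma UNIV ?E \<rightarrow>\<^sub>M bits"
      by (simp add: measurable_bits_iff)
    then show "sets bits \<subseteq> sigma_sets UNIV ?E"
      by (auto dest: measurable_sets)
    show "sigma_sets UNIV ?E \<subseteq> sets bits"
      using sets.sigma_sets_subset[of ?E bits] sets_cyl by (simp add: image_subset_iff)
  qed
  then show "sets \<mu> = sigma_sets UNIV ?E" "sets \<nu> = sigma_sets UNIV ?E"
    using \<mu> \<nu> by auto
  show "emeasure \<mu> (cyl []) \<noteq> \<infinity>" for i :: nat
    using \<mu>(1) by (simp add: finite_measure.emeasure_finite)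
  show "range (\<lambda>_ :: nat. cyl []) \<subseteq> insert {} (range cyl)" "(\<Union>i :: nat. cyl []) = UNIV"
    by simp (auto simp: cyl_def pref_def)
qed (use eq in auto)

text \<open>A function of the first \<open>m\<close> bits is a finite linear combination of
  indicators of cylinders of length \<open>m\<close>.\<close>

lemma integral_pref:
  fixes g :: "bool list \<Rightarrow> real"
  assumes "finite_measure \<mu>" and s: "sets \<mu> = sets bits"
  shows "integrable \<mu> (\<lambda>y. g (pref m y))"
    and "(\<integral>y. g (pref m y) \<partial>\<mu>) = (\<Sum>s | length s = m. g s * measure \<mu> (cyl s))"
proof -
  interpret finite_measure \<mu> by fact
  note [measurable_cong] = s
  have *: "g (pref m y) = (\<Sum>s | length s = m. g s * indicator (cyl s) y)" for y
  proof -
    have "(\<Sum>s | length s = m. g s * indicator (cyl s) y) = (\<Sum>s\<in>{pref m y}. g s)"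
      by (rule sum.mono_neutral_cong_right) (auto simp: finite_lists_length cyl_def indicator_def)
    then show ?thesis by simp
  qed
  have i: "integrable \<mu> (\<lambda>y. g s * indicator (cyl s) y)" for s
    by (intro integrable_mult_right integrable_real_indicator) (auto simp: s emeasure_finite less_top[symmetric])
  show "integrable \<mu> (\<lambda>y. g (pref m y))"
    unfolding * using i by (intro Bochner_Integration.integrable_sum)
  have "(\<integral>y. g (pref m y) \<partial>\<mu>) = (\<Sum>s | length s = m. \<integral>y. g s * indicator (cyl s) y \<partial>\<mu>)"
    unfolding * using i by (intro Bochner_Integration.integral_sum)
  also have "\<dots> = (\<Sum>s | length s = m. g s * measure \<mu> (cyl s))"
    using sets.Int_space_eq2[of "cyl _" \<mu>] s by simp
  finally show "(\<integral>y. g (pref m y) \<partial>\<mu>) = (\<Sum>s | length s = m. g s * measure \<mu> (cyl s))" .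
qed

section \<open>Densities depending measurably on a parameter\<close>

text \<open>On a cylinder that is null for \<open>\<mu>\<close> the quotient is 0 by the convention
  for division. When \<open>\<nu>\<close> is dominated by \<open>\<mu>\<close> the numerator
  vanishes there too, so \<open>ratio\<close> times the \<open>\<mu>\<close>-mass is always the
  \<open>\<nu>\<close>-mass.\<close>

definition ratio :: "(nat \<Rightarrow> bool) measure \<Rightarrow> (nat \<Rightarrow> bool) measure \<Rightarrow> bool list \<Rightarrow> real" where
  "ratio \<mu> \<nu> s = measure \<nu> (cyl s) / measure \<mu> (cyl s)"

text \<open>For \<open>\<nu>\<close> dominated by \<open>\<mu>\<close> this is the second moment
  under \<open>\<mu>\<close> of the ratio at level \<open>m\<close>. As a finite sum over cylinder
  masses it is visibly measurable in a parameter.\<close>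

definition energy :: "(nat \<Rightarrow> bool) measure \<Rightarrow> (nat \<Rightarrow> bool) measure \<Rightarrow> nat \<Rightarrow> real" where
  "energy \<mu> \<nu> m = (\<Sum>s | length s = m. ratio \<mu> \<nu> s * measure \<nu> (cyl s))"

text \<open>The energy at the chosen level is within \<open>(1/4)^j\<close> of its supremum, which
  bounds every later squared increment. The constraint \<open>j \<le> m\<close> sends the levels to
  infinity, and taking the least one keeps the choice measurable.\<close>

definition level_index :: "(nat \<Rightarrow> bool) measure \<Rightarrow> (nat \<Rightarrow> bool) measure \<Rightarrow> nat \<Rightarrow> nat" where
  "level_index \<mu> \<nu> j = (LEAST m. j \<le> m \<and> (\<forall>m'. energy \<mu> \<nu> m' \<le> energy \<mu> \<nu> m + (1/4)^j))"

text \<open>The ratios \<open>\<nu>(I)/\<mu>(I)\<close> over the cylinders of length \<open>m\<close> form an \<open>L\<^sup>2\<close>-bounded martingale under \<open>\<mu>\<close>,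
  whose squared increments are the differences of \<^const>\<open>energy\<close>. Passing to the subsequence
  \<^const>\<open>level_index\<close>, which is measurable in the two measures, makes the increments summable almost
  everywhere, so that no martingale convergence theorem is needed.\<close>

definition lim_ratio :: "(nat \<Rightarrow> bool) measure \<Rightarrow> (nat \<Rightarrow> bool) measure \<Rightarrow> (nat \<Rightarrow> bool) \<Rightarrow> real" where
  "lim_ratio \<mu> \<nu> y = max 0 (min 1 (lim (\<lambda>j. ratio \<mu> \<nu> (pref (level_index \<mu> \<nu> j) y))))"

text \<open>The clamping gives this bound at every point, also where the ratios diverge and
  \<open>lim\<close> is an arbitrary number.\<close>

lemma lim_ratio_nonneg: "0 \<le> lim_ratio \<mu> \<nu> y"
  by (simp add: lim_ratio_def)

text \<open>Only countably many operations on cylinder masses are involved: finite sums, a least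
  index, evaluation at a countably valued index, a limit. Joint measurability in parameter and point
  is the gain over a Radon-Nikodym density chosen separately for each parameter.\<close>

lemma measurable_lim_ratio:
  assumes [measurable]: "\<And>s. (\<lambda>z. measure (\<mu> z) (cyl s)) \<in> borel_measurable S"
    "\<And>s. (\<lambda>z. measure (\<nu> z) (cyl s)) \<in> borel_measurable S"
  shows "(\<lambda>(z, y). lim_ratio (\<mu> z) (\<nu> z) y) \<in> borel_measurable (S \<Otimes>\<^sub>M bits)"
proof -
  have [measurable]: "(\<lambda>z. ratio (\<mu> z) (\<nu> z) s) \<in> borel_measurable S" for s
    unfolding ratio_def by measurable
  have [measurable]: "(\<lambda>z. energy (\<mu> z) (\<nu> z) m) \<in> borel_measurable S" for m
    unfolding energy_def by measurable
  have l: "(\<lambda>z. level_index (\<mu> z) (\<nu> z) j) \<in> S \<rightarrow>\<^sub>M count_space UNIV" for j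
    unfolding level_index_def by measurable
  have r: "(\<lambda>x. ratio (\<mu> (fst x)) (\<nu> (fst x)) (pref m (snd x))) \<in> borel_measurable (S \<Otimes>\<^sub>M bits)" for m
    by (rule measurable_compose_countable[where f = "\<lambda>s x. ratio (\<mu> (fst x)) (\<nu> (fst x)) s"
          and g = "\<lambda>x. pref m (snd x)"]) measurable
  have [measurable]: "(\<lambda>x. ratio (\<mu> (fst x)) (\<nu> (fst x)) (pref (level_index (\<mu> (fst x)) (\<nu> (fst x)) j) (snd x)))
      \<in> borel_measurable (S \<Otimes>\<^sub>M bits)" for j
    by (rule measurable_compose_countable[where
          f = "\<lambda>m x. ratio (\<mu> (fst x)) (\<nu> (fst x)) (pref m (snd x))"
          and g = "\<lambda>x. level_index (\<mu> (fst x)) (\<nu> (fst x)) j", OF r])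
       (rule measurable_compose[OF measurable_fst l])
  show ?thesis
    unfolding lim_ratio_def case_prod_unfold by measurable
qed

text \<open>Along the chosen levels the ratios converge almost everywhere and stay in
  \<open>[0,1]\<close>. Their integrals over a fixed cylinder are eventually the
  \<open>\<nu>\<close>-mass, so dominated convergence identifies the limit as the density.\<close>

lemma density_lim_ratio:
  assumes \<mu>: "prob_space \<mu>" "sets \<mu> = sets bits" and \<nu>: "sets \<nu> = sets bits"
    and le: "\<And>B. B \<in> sets bits \<Longrightarrow> emeasure \<nu> B \<le> emeasure \<mu> B"
  shows "density \<mu> (\<lambda>y. ennreal (lim_ratio \<mu> \<nu> y)) = \<nu>"
proof -
  interpret \<mu>: prob_space \<mu> by fact
  note [measurable_cong] = \<mu>(2) \<nu>
  have sp: "space \<mu> = UNIV" "space \<nu> = UNIV"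
    using \<mu>(2) \<nu> by (auto dest: sets_eq_imp_space_eq)
  have "emeasure \<nu> (space \<nu>) \<noteq> \<infinity>"
    using le[of UNIV] sets.top[of bits] sp \<mu>.emeasure_space_1 by (auto simp: top_unique)
  then interpret \<nu>: finite_measure \<nu>
    by (rule finite_measureI)
  note fm = \<mu>.finite_measure_axioms \<nu>.finite_measure_axioms
  have mle: "measure \<nu> (cyl s) \<le> measure \<mu> (cyl s)" for s
    using le[OF sets_cyl, of s] by (simp add: \<mu>.emeasure_eq_measure \<nu>.emeasure_eq_measure)
  define F where "F m y = ratio \<mu> \<nu> (pref m y)" for m y
  have F01: "0 \<le> F m y" "F m y \<le> 1" for m y
    using mle by (auto simp: F_def ratio_def divide_le_eq zero_less_measure_iff
        intro: order_antisym[OF _ measure_nonneg])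
  have [measurable]: "F m \<in> borel_measurable \<mu>" for m
    unfolding F_def by measurable
  \<comment> \<open>The martingale property, tested against functions of the first \<open>m\<close>
    bits: a finer ratio converts \<open>\<mu>\<close>-mass into \<open>\<nu>\<close>-mass cylinder
    by cylinder.\<close>
  have key: "(\<integral>y. g (pref m y) * F m' y \<partial>\<mu>) = (\<integral>y. g (pref m y) \<partial>\<nu>)" if "m \<le> m'"
    for g :: "bool list \<Rightarrow> real" and m m'
  proof -
    have p: "g (pref m y) = g (take m (pref m' y))" for y
      using that by (simp add: take_pref)
    have r: "ratio \<mu> \<nu> s * measure \<mu> (cyl s) = measure \<nu> (cyl s)" for s
      using mle[of s] by (auto simp: ratio_def intro: order_antisym[OF _ measure_nonneg])
    show ?thesis
      unfolding p F_def
      by (subst integral_pref(2)[OF fm(1) \<mu>(2), of "\<lambda>s. g (take m s) * ratio \<mu> \<nu> s"],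
          subst integral_pref(2)[OF fm(2) \<nu>, of "\<lambda>s. g (take m s)"])
         (simp add: mult.assoc r)
  qed
  let ?a = "energy \<mu> \<nu>"
  have a: "?a m = (\<integral>y. F m y \<partial>\<nu>)" for m
    unfolding F_def energy_def by (rule integral_pref(2)[OF fm(2) \<nu>, symmetric])
  have FF: "(\<integral>y. F m y * F m' y \<partial>\<mu>) = ?a m" if "m \<le> m'" for m m'
    using key[OF that, of "ratio \<mu> \<nu>"] by (simp add: a F_def)
  have int: "integrable \<mu> (\<lambda>y. F m y * F m' y)" for m m'
    using F01 by (intro \<mu>.integrable_const_bound[where B = 1])
      (auto simp: abs_mult intro!: mult_le_one)
  \<comment> \<open>Increments are orthogonal to the past: by \<open>FF\<close> the cross terms
    equal the earlier energy.\<close>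
  have diff: "(\<integral>y. (F m' y - F m y)^2 \<partial>\<mu>) = ?a m' - ?a m" if "m \<le> m'" for m m'
  proof -
    have "(\<integral>y. (F m' y - F m y)^2 \<partial>\<mu>) =
        (\<integral>y. F m' y * F m' y - (F m y * F m' y + F m y * F m' y) + F m y * F m y \<partial>\<mu>)"
      by (intro Bochner_Integration.integral_cong) (auto simp: power2_eq_square algebra_simps)
    also have "\<dots> = ?a m' - (?a m + ?a m) + ?a m"
      using that FF[OF that] by (simp add: int FF mult.commute[of "F m' _" "F m _"])
    finally show ?thesis by simp
  qed
  have mono: "?a m \<le> ?a m'" if "m \<le> m'" for m m'
  proof -
    have "0 \<le> (\<integral>y. (F m' y - F m y)^2 \<partial>\<mu>)"
      by (rule Bochner_Integration.integral_nonneg) simp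
    then show ?thesis using diff[OF that] by simp
  qed
  have "?a m \<le> 1" for m
    unfolding FF[OF order_refl, symmetric]
    using F01 int by (intro \<mu>.integral_le_const) (auto intro!: mult_le_one)
  moreover have "0 \<le> ?a m" for m
    by (simp add: energy_def ratio_def sum_nonneg)
  ultimately have "convergent ?a"
    by (intro Bseq_mono_convergent BseqI'[where K = 1] allI impI mono) auto
  then have "Cauchy ?a" by (simp add: Cauchy_convergent_iff)
  \<comment> \<open>Any level past the Cauchy threshold works; monotonicity of the energy covers the
    earlier \<open>m'\<close>.\<close>
  have lev_ex: "\<exists>m. j \<le> m \<and> (\<forall>m'. ?a m' \<le> ?a m + (1/4)^j)" for j
  proof -
    obtain M where M: "\<And>m n. M \<le> m \<Longrightarrow> M \<le> n \<Longrightarrow> \<bar>?a m - ?a n\<bar> < (1/4)^j"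
      using \<open>Cauchy ?a\<close> unfolding Cauchy_def dist_real_def
      by (meson zero_less_power zero_less_divide_iff zero_less_numeral zero_less_one)
    have "?a m' \<le> ?a (max j M) + (1/4)^j" for m'
      using M[of "max m' M" "max j M"] mono[of m' "max m' M"] by auto
    then show ?thesis by (intro exI[of _ "max j M"]) auto
  qed
  let ?l = "level_index \<mu> \<nu>"
  have lev: "j \<le> ?l j" "?a m' \<le> ?a (?l j) + (1/4)^j" for j m'
    unfolding level_index_def using LeastI_ex[OF lev_ex[of j]] by auto
  \<comment> \<open>The requirement for \<open>Suc j\<close> implies the one for \<open>j\<close>,
    so the least level for \<open>j\<close> cannot be larger.\<close>
  have lev_mono: "?l j \<le> ?l (Suc j)" for j
  proof -
    have "(1/4::real)^Suc j \<le> (1/4)^j"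
      by (intro power_decreasing) auto
    then have "j \<le> ?l (Suc j) \<and> (\<forall>m'. ?a m' \<le> ?a (?l (Suc j)) + (1/4)^j)"
      using lev(1)[of "Suc j"] by (auto intro!: order_trans[OF lev(2)[of _ "Suc j"]] add_left_mono)
    then show ?thesis
      unfolding level_index_def[of _ _ j] by (rule Least_le)
  qed
  define G where "G j = F (?l j)" for j
  have [measurable]: "G j \<in> borel_measurable \<mu>" for j
    unfolding G_def by measurable
  have G01: "0 \<le> G j y" "G j y \<le> 1" for j y
    by (simp_all add: G_def F01)
  have Gint: "integrable \<mu> (\<lambda>y. (G (Suc j) y - G j y)^2)" "integrable \<mu> (\<lambda>y. \<bar>G (Suc j) y - G j y\<bar>)" for j
  proof -
    have *: "\<bar>G (Suc j) y - G j y\<bar> \<le> 1" for y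
      using G01[of j y] G01[of "Suc j" y] by linarith
    show "integrable \<mu> (\<lambda>y. (G (Suc j) y - G j y)^2)"
      using * by (intro \<mu>.integrable_const_bound[where B = 1]) (auto simp: abs_square_le_1)
    show "integrable \<mu> (\<lambda>y. \<bar>G (Suc j) y - G j y\<bar>)"
      using * by (intro \<mu>.integrable_const_bound[where B = 1]) auto
  qed
  have L1: "(\<integral>y. \<bar>G (Suc j) y - G j y\<bar> \<partial>\<mu>) \<le> (1/2)^j" for j
  proof -
    \<comment> \<open>A weighted arithmetic-geometric inequality in place of Cauchy-Schwarz: for a
      mean square of at most \<open>(1/4)^j\<close>, the weight \<open>2^j\<close> balances both
      terms at \<open>(1/2)^j\<close>.\<close>
    have am: "\<bar>d\<bar> \<le> (2^j * d^2 + (1/2)^j) / 2" for d :: real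
    proof -
      have "0 \<le> (2^j * \<bar>d\<bar> - 1)^2 / 2^j" by simp
      also have "\<dots> = 2^j * d^2 - 2 * \<bar>d\<bar> + (1/2)^j"
        by (simp add: power2_eq_square field_simps power_divide)
      finally show ?thesis by (simp add: field_simps)
    qed
    have "(\<integral>y. \<bar>G (Suc j) y - G j y\<bar> \<partial>\<mu>) \<le> (\<integral>y. (2^j * (G (Suc j) y - G j y)^2 + (1/2)^j) / 2 \<partial>\<mu>)"
      using Gint by (intro integral_mono am) auto
    also have "\<dots> = (2^j * (?a (?l (Suc j)) - ?a (?l j)) + (1/2)^j) / 2"
      using Gint(1) by (simp add: G_def diff[OF lev_mono] \<mu>.prob_space)
    also have "\<dots> \<le> (2^j * (1/4)^j + (1/2)^j) / 2"
      using lev(2)[of "?l (Suc j)" j] by (intro divide_right_mono add_mono mult_left_mono) auto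
    also have "2^j * (1/4)^j = (1/2::real)^j"
      by (simp add: power_mult_distrib[symmetric])
    finally show ?thesis by simp
  qed
  \<comment> \<open>The expected total variation is at most a geometric series, so almost every
    telescoping series of increments converges absolutely.\<close>
  have "AE y in \<mu>. convergent (\<lambda>j. G j y)"
  proof -
    have "(\<integral>\<^sup>+y. (\<Sum>j. ennreal \<bar>G (Suc j) y - G j y\<bar>) \<partial>\<mu>) = (\<Sum>j. \<integral>\<^sup>+y. ennreal \<bar>G (Suc j) y - G j y\<bar> \<partial>\<mu>)"
      by (intro nn_integral_suminf) simp
    also have "\<dots> \<le> (\<Sum>j. ennreal ((1/2)^j))"
      using Gint(2) L1 by (intro suminf_le) (auto simp: nn_integral_eq_integral ennreal_leI)
    also have "\<dots> = ennreal (\<Sum>j. (1/2)^j)"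
      by (intro suminf_ennreal2) (auto intro: summable_geometric)
    also have "\<dots> < \<infinity>" by simp
    finally have "AE y in \<mu>. (\<Sum>j. ennreal \<bar>G (Suc j) y - G j y\<bar>) \<noteq> \<infinity>"
      by (intro nn_integral_PInf_AE) auto
    then show ?thesis
    proof eventually_elim
      case (elim y)
      then have "summable (\<lambda>j. \<bar>G (Suc j) y - G j y\<bar>)"
        by (intro summable_suminf_not_top) auto
      then have "summable (\<lambda>j. G (Suc j) y - G j y)"
        by (rule summable_rabs_cancel)
      then have "convergent (\<lambda>n. \<Sum>j<n. G (Suc j) y - G j y)"
        by (simp add: summable_iff_convergent)
      then have "convergent (\<lambda>n. G n y - G 0 y)"
        by (simp only: sum_lessThan_telescope[of "\<lambda>n. G n y"])
      then have "convergent (\<lambda>n. G n y - G 0 y + G 0 y)"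
        by (rule convergent_add[OF _ convergent_const])
      then show ?case by simp
    qed
  qed
  then have lim: "AE y in \<mu>. (\<lambda>j. G j y) \<longlonglongrightarrow> lim_ratio \<mu> \<nu> y"
  proof eventually_elim
    case (elim y)
    then have "(\<lambda>j. G j y) \<longlonglongrightarrow> lim (\<lambda>j. G j y)"
      by (simp add: convergent_LIMSEQ_iff)
    then have "(\<lambda>j. max 0 (min 1 (G j y))) \<longlonglongrightarrow> max 0 (min 1 (lim (\<lambda>j. G j y)))"
      by (intro tendsto_intros)
    moreover have "max 0 (min 1 (G j y)) = G j y" for j
      using G01[of j y] by (simp add: max_def min_def)
    ultimately show ?case
      by (simp add: lim_ratio_def G_def F_def)
  qed
  have [measurable]: "lim_ratio \<mu> \<nu> \<in> borel_measurable \<mu>"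
    unfolding lim_ratio_def by measurable
  have "(\<integral>y. indicator (cyl s) y * lim_ratio \<mu> \<nu> y \<partial>\<mu>) = measure \<nu> (cyl s)" for s
  proof (rule LIMSEQ_unique)
    show "(\<lambda>j. \<integral>y. indicator (cyl s) y * G j y \<partial>\<mu>) \<longlonglongrightarrow> (\<integral>y. indicator (cyl s) y * lim_ratio \<mu> \<nu> y \<partial>\<mu>)"
    proof (rule integral_dominated_convergence[where w = "\<lambda>_. 1"])
      show "AE y in \<mu>. (\<lambda>j. indicator (cyl s) y * G j y) \<longlonglongrightarrow> indicator (cyl s) y * lim_ratio \<mu> \<nu> y"
        using lim by eventually_elim (intro tendsto_intros)
      show "AE y in \<mu>. norm (indicator (cyl s) y * G j y) \<le> 1" for j
        using G01 by (auto simp: indicator_def)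
    qed auto
    \<comment> \<open>From here on \<open>length s \<le> j \<le> ?l j\<close>, so \<open>key\<close>
      applies to the indicator of the cylinder.\<close>
    have "(\<integral>y. indicator (cyl s) y * G j y \<partial>\<mu>) = measure \<nu> (cyl s)" if "length s \<le> j" for j
    proof -
      have c: "indicator (cyl s) y = (indicator {s} (pref (length s) y) :: real)" for y
        by (auto simp: cyl_def indicator_def)
      have "(\<integral>y. indicator (cyl s) y * G j y \<partial>\<mu>) = (\<integral>y. indicator (cyl s) y \<partial>\<nu>)"
        unfolding c G_def using that lev(1)[of j] by (intro key) auto
      then show ?thesis by (simp add: sp)
    qed
    then show "(\<lambda>j. \<integral>y. indicator (cyl s) y * G j y \<partial>\<mu>) \<longlonglongrightarrow> measure \<nu> (cyl s)"
      by (intro tendsto_eventually eventually_sequentiallyI)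
  qed
  then have eq: "emeasure (density \<mu> (\<lambda>y. ennreal (lim_ratio \<mu> \<nu> y))) (cyl s) = emeasure \<nu> (cyl s)" for s
  proof -
    have i: "integrable \<mu> (\<lambda>y. indicator (cyl s) y * lim_ratio \<mu> \<nu> y)"
      by (intro \<mu>.integrable_const_bound[where B = 1]) (auto simp: indicator_def lim_ratio_def)
    have "emeasure (density \<mu> (\<lambda>y. ennreal (lim_ratio \<mu> \<nu> y))) (cyl s) =
        (\<integral>\<^sup>+y. ennreal (indicator (cyl s) y * lim_ratio \<mu> \<nu> y) \<partial>\<mu>)"
      by (subst emeasure_density) (auto simp: indicator_def intro!: nn_integral_cong)
    also have "\<dots> = ennreal (\<integral>y. indicator (cyl s) y * lim_ratio \<mu> \<nu> y \<partial>\<mu>)"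
      using i by (intro nn_integral_eq_integral) (auto simp: indicator_def lim_ratio_nonneg)
    finally show ?thesis
      using \<open>\<And>s. (\<integral>y. indicator (cyl s) y * lim_ratio \<mu> \<nu> y \<partial>\<mu>) = measure \<nu> (cyl s)\<close>
      by (simp add: \<nu>.emeasure_eq_measure)
  qed
  show ?thesis
    using eq by (intro bits_measure_eqI[symmetric] fm) (auto simp: \<mu>(2) \<nu>)
qed

section \<open>Universally measurable sets and maps\<close>

lemma Rep_omega_bounds [simp]: "0 \<le> Rep_omega w n" "Rep_omega w n \<le> 1"
  using Rep_omega[of w] by auto

lemma measurable_Rep_omega [measurable]: "(\<lambda>w. Rep_omega w n) \<in> borel_measurable borel"
proof -
  have "continuous_on UNIV Rep_omega"
    by (simp add: continuous_on_open_vimage) (auto simp: open_omega_def)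
  then have "Rep_omega \<in> borel_measurable borel"
    by (rule borel_measurable_continuous_onI)
  then show ?thesis
    by (rule measurable_product_then_coordinatewise)
qed

text \<open>Open sets of \<open>omega\<close> are preimages of open sets of real sequences, whose
  Borel sets are those of the countable product.\<close>

lemma measurable_omega_iff:
  "f \<in> M \<rightarrow>\<^sub>M (borel :: omega measure) \<longleftrightarrow> (\<forall>n. (\<lambda>x. Rep_omega (f x) n) \<in> borel_measurable M)"
proof
  assume [measurable]: "f \<in> M \<rightarrow>\<^sub>M (borel :: omega measure)"
  show "\<forall>n. (\<lambda>x. Rep_omega (f x) n) \<in> borel_measurable M"
    by (auto intro: measurable_compose[OF _ measurable_Rep_omega])
next
  assume "\<forall>n. (\<lambda>x. Rep_omega (f x) n) \<in> borel_measurable M"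
  then have *: "(\<lambda>x. Rep_omega (f x)) \<in> borel_measurable M"
    by (intro measurable_coordinatewise_then_product) auto
  show "f \<in> M \<rightarrow>\<^sub>M borel"
  proof (rule borel_measurableI)
    fix S :: "omega set" assume "open S"
    then obtain V where V: "open V" "S = Rep_omega -` V"
      by (auto simp: open_omega_def)
    then have "(\<lambda>x. Rep_omega (f x)) -` V \<inter> space M \<in> sets M"
      using * by (intro measurable_sets) auto
    then show "f -` S \<inter> space M \<in> sets M"
      by (simp add: V vimage_def)
  qed
qed

text \<open>Clamping makes this total, so maps into \<open>omega\<close> can be built coordinatewise
  without range conditions.\<close>

definition clip :: "(nat \<Rightarrow> real) \<Rightarrow> omega" where
  "clip x = Abs_omega (\<lambda>n. max 0 (min 1 (x n)))"

lemma Rep_clip: "Rep_omega (clip x) n = max 0 (min 1 (x n))"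
  by (simp add: clip_def Abs_omega_inverse)

lemma clamp_Rep [simp]: "max 0 (min 1 (Rep_omega w n)) = Rep_omega w n"
  by (simp add: min_absorb2 max_absorb2)

lemma clip_Rep [simp]: "clip (Rep_omega w) = w"
  by (simp add: clip_def Rep_omega_inverse)

lemma measurable_clip [measurable (raw)]:
  assumes [measurable]: "\<And>n. (\<lambda>x. g x n) \<in> borel_measurable M"
  shows "(\<lambda>x. clip (g x)) \<in> M \<rightarrow>\<^sub>M borel"
  by (simp add: measurable_omega_iff Rep_clip)

text \<open>Turns a pair into a single point, so that sets of pairs can be tested against
  \<open>B_Omega\<close>.\<close>

definition interleave :: "omega \<Rightarrow> omega \<Rightarrow> omega" where
  "interleave w v = clip (\<lambda>n. if even n then Rep_omega w (n div 2) else Rep_omega v (n div 2))"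

definition evens :: "omega \<Rightarrow> omega" where
  "evens w = clip (\<lambda>n. Rep_omega w (2 * n))"

definition odds :: "omega \<Rightarrow> omega" where
  "odds w = clip (\<lambda>n. Rep_omega w (Suc (2 * n)))"

lemma evens_interleave [simp]: "evens (interleave w v) = w" and odds_interleave [simp]: "odds (interleave w v) = v"
  by (simp_all add: evens_def odds_def interleave_def Rep_clip)

lemma measurable_interleave [measurable]: "(\<lambda>(w, v). interleave w v) \<in> borel \<Otimes>\<^sub>M borel \<rightarrow>\<^sub>M borel"
  and measurable_evens [measurable]: "evens \<in> borel \<rightarrow>\<^sub>M borel"
  and measurable_odds [measurable]: "odds \<in> borel \<rightarrow>\<^sub>M borel"
  unfolding interleave_def evens_def odds_def case_prod_unfold by measurable

section \<open>Measurability for the universal completion\<close>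

lemma borel_B_Omega: "A \<in> sets borel \<Longrightarrow> A \<in> sets B_Omega"
  by (auto simp: sets_B_Omega universally_measurable_sets_def)

lemma measurable_borel_B_Omega: "f \<in> borel \<rightarrow>\<^sub>M N \<Longrightarrow> f \<in> B_Omega \<rightarrow>\<^sub>M N"
  by (auto simp: measurable_def borel_B_Omega)

lemma measurable_B_OmegaI:
  assumes "\<And>M. prob_space M \<Longrightarrow> sets M = sets borel \<Longrightarrow> f \<in> completion M \<rightarrow>\<^sub>M N"
  shows "f \<in> B_Omega \<rightarrow>\<^sub>M N"
proof (rule measurableI)
  \<comment> \<open>Some probability measure is needed to see that \<open>f\<close> takes values in
    \<open>space N\<close>; a point mass will do.\<close>
  let ?M = "return borel (undefined :: omega)"
  have "f \<in> completion ?M \<rightarrow>\<^sub>M N"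
    by (intro assms prob_space_return) auto
  then show "f x \<in> space N" for x
    by (auto simp: measurable_def)
next
  fix A assume A: "A \<in> sets N"
  have "f -` A \<in> sets (completion M)" if M: "prob_space M" "sets M = sets borel" for M
    using measurable_sets[OF assms[OF that] A] sets_eq_imp_space_eq[OF M(2)] by simp
  then show "f -` A \<inter> space B_Omega \<in> sets B_Omega"
    by (simp add: sets_B_Omega universally_measurable_sets_def)
qed

text \<open>A completion adds only subsets of null sets. The choice of \<open>M\<close> matters in
  each use: it decides in which sense the two Borel sets are close.\<close>

lemma B_Omega_sandwich:
  assumes "C \<in> sets B_Omega" "prob_space M" "sets M = sets borel"
  obtains C1 C2 where "C1 \<in> sets borel" "C2 \<in> sets borel" "C1 \<subseteq> C" "C \<subseteq> C2" "C2 - C1 \<in> null_sets M"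
proof -
  have "C \<in> sets (completion M)"
    using assms by (auto simp: sets_B_Omega universally_measurable_sets_def)
  then obtain S N N' where C: "C = S \<union> N" "N \<subseteq> N'" "N' \<in> null_sets M" "S \<in> sets M"
    by (rule sets_completionE)
  then have "S \<union> N' - S \<in> null_sets M"
    by (intro null_sets_subset[OF C(3)]) auto
  then show thesis
    using that[of S "S \<union> N'"] C assms(3) by auto
qed

text \<open>Sandwich the target set with respect to the law of \<open>f\<close>. The preimage of the
  gap is null, and completeness of the domain absorbs the rest.\<close>

lemma measurable_completion_B_Omega:
  assumes M: "prob_space M" and f: "f \<in> completion M \<rightarrow>\<^sub>M borel"
  shows "f \<in> completion M \<rightarrow>\<^sub>M B_Omega"
proof (rule measurableI)
  interpret prob_space "completion M"
    using M by (simp add: prob_space.prob_space_completion)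
  fix C assume "C \<in> sets B_Omega"
  moreover have "prob_space (distr (completion M) borel f)"
    using f by (rule prob_space_distr)
  ultimately obtain C1 C2 where C: "C1 \<in> sets borel" "C2 \<in> sets borel" "C1 \<subseteq> C" "C \<subseteq> C2"
      "C2 - C1 \<in> null_sets (distr (completion M) borel f)"
    by (rule B_Omega_sandwich) auto
  let ?v = "\<lambda>A. f -` A \<inter> space (completion M)"
  have "?v (C2 - C1) \<in> null_sets (completion M)"
    using C(5) f by (simp add: null_sets_distr_iff)
  then have "?v (C - C1) \<in> null_sets (completion M)"
    by (rule completion.complete2[rotated]) (use C in auto)
  moreover have "?v C1 \<in> sets (completion M)"
    using f C by (intro measurable_sets) auto
  moreover have "?v C = ?v C1 \<union> ?v (C - C1)"
    using C by auto
  ultimately show "?v C \<in> sets (completion M)"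
    by (metis null_setsD2 sets.Un)
qed simp

lemma B_Omega_sets_completion:
  "prob_space M \<Longrightarrow> sets M = sets borel \<Longrightarrow> C \<in> sets B_Omega \<Longrightarrow> C \<in> sets (completion M)"
  by (auto simp: sets_B_Omega universally_measurable_sets_def)

lemma measurable_B_Omega_completion:
  assumes M: "prob_space M" "sets M = sets borel" and f: "f \<in> B_Omega \<rightarrow>\<^sub>M N"
  shows "f \<in> completion M \<rightarrow>\<^sub>M N"
  using f B_Omega_sets_completion[OF M] sets_eq_imp_space_eq[OF M(2)] by (auto simp: measurable_def)

text \<open>On a universally completed domain the finer codomain comes for free, so Borel
  constructions yield admissible reparametrisations of \<Omega>.\<close>

lemma measurable_B_Omega_upgrade:
  "f \<in> B_Omega \<rightarrow>\<^sub>M borel \<Longrightarrow> f \<in> B_Omega \<rightarrow>\<^sub>M B_Omega"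
  by (rule measurable_B_OmegaI) (rule measurable_completion_B_Omega, assumption, rule measurable_B_Omega_completion)

lemma measurable_id_B_Omega: "(\<lambda>w. w) \<in> B_Omega \<rightarrow>\<^sub>M borel"
  by (rule measurable_borel_B_Omega) simp

section \<open>Passing between Borel probabilities and probabilities on
  \<open>B_Omega\<close>\<close>

lemma omega_probs_distr_borel:
  assumes "P \<in> omega_probs"
  shows "prob_space (distr P borel (\<lambda>w. w))"
    and "A \<in> sets borel \<Longrightarrow> emeasure (distr P borel (\<lambda>w. w)) A = emeasure P A"
proof -
  have P: "prob_space P" "sets P = sets B_Omega" "space P = UNIV"
    using assms sets_eq_imp_space_eq[of P B_Omega] by (auto simp: omega_probs_def)
  have m: "(\<lambda>w. w) \<in> P \<rightarrow>\<^sub>M borel"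
    using measurable_id_B_Omega P by (simp cong: measurable_cong_sets)
  show "prob_space (distr P borel (\<lambda>w. w))"
    using P m by (intro prob_space.prob_space_distr)
  show "A \<in> sets borel \<Longrightarrow> emeasure (distr P borel (\<lambda>w. w)) A = emeasure P A"
    using m P by (simp add: emeasure_distr)
qed

lemma omega_probs_completion:
  assumes M: "prob_space M" "sets M = sets borel"
  shows "distr (completion M) B_Omega (\<lambda>w. w) \<in> omega_probs"
    and "A \<in> sets borel \<Longrightarrow> emeasure (distr (completion M) B_Omega (\<lambda>w. w)) A = emeasure M A"
proof -
  have m: "(\<lambda>w. w) \<in> completion M \<rightarrow>\<^sub>M B_Omega"
    by (rule measurable_B_Omega_completion[OF M]) simp
  interpret prob_space "completion M"
    using M by (simp add: prob_space.prob_space_completion)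
  show "distr (completion M) B_Omega (\<lambda>w. w) \<in> omega_probs"
    using prob_space_distr[OF m] by (simp add: omega_probs_def)
  show "A \<in> sets borel \<Longrightarrow> emeasure (distr (completion M) B_Omega (\<lambda>w. w)) A = emeasure M A"
    using m M sets_eq_imp_space_eq[OF M(2)] by (simp add: emeasure_distr borel_B_Omega)
qed

lemma omega_probs_sandwich:
  assumes "P \<in> omega_probs" "C \<in> sets B_Omega"
  obtains C1 C2 where "C1 \<in> sets borel" "C2 \<in> sets borel" "C1 \<subseteq> C" "C \<subseteq> C2" "emeasure P (C2 - C1) = 0"
proof (rule B_Omega_sandwich[OF assms(2) omega_probs_distr_borel(1)[OF assms(1)]])
  fix C1 C2 :: "omega set"
  assume *: "C1 \<in> sets borel" "C2 \<in> sets borel" "C1 \<subseteq> C" "C \<subseteq> C2"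
    "C2 - C1 \<in> null_sets (distr P borel (\<lambda>w. w))"
  then have "emeasure P (C2 - C1) = 0"
    using omega_probs_distr_borel(2)[OF assms(1), of "C2 - C1"] by auto
  then show thesis using * that by blast
qed simp

text \<open>The set \<open>A\<close> need not lie in the product \<open>\<sigma>\<close>-algebra of \<^const>\<open>B_Omega\<close> with itself; the
  hypothesis says that it is universally measurable after identifying \<open>\<Omega> \<times> \<Omega>\<close> with \<open>\<Omega>\<close> by
  interleaving coordinates.\<close>

lemma measurable_measure_section:
  assumes P: "P \<in> omega_probs"
    and A: "\<And>\<phi> \<psi>. \<phi> \<in> B_Omega \<rightarrow>\<^sub>M B_Omega \<Longrightarrow> \<psi> \<in> B_Omega \<rightarrow>\<^sub>M B_Omega \<Longrightarrow>
      {w. (\<phi> w, \<psi> w) \<in> A} \<in> sets B_Omega"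
  shows "(\<lambda>z. measure P {w. (z, w) \<in> A}) \<in> borel_measurable B_Omega"
proof (rule measurable_B_OmegaI)
  fix M :: "omega measure" assume M: "prob_space M" "sets M = sets borel"
  have spM: "space M = UNIV" using M(2) by (auto dest: sets_eq_imp_space_eq)
  define P0 where "P0 = distr P borel (\<lambda>w. w)"
  have sP: "sets P = sets B_Omega" "space P = UNIV"
    using P sets_eq_imp_space_eq[of P B_Omega] by (auto simp: omega_probs_def)
  interpret M: prob_space M by fact
  interpret P: prob_space P using P by (simp add: omega_probs_def)
  interpret P0: prob_space P0
    using P by (simp add: omega_probs_distr_borel P0_def)
  interpret MP: pair_prob_space M P0 ..
  have sP0: "sets P0 = sets borel" by (simp add: P0_def)
  have P0: "measure P0 B = measure P B" if "B \<in> sets borel" for B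
    using that P by (simp add: P0_def measure_def omega_probs_distr_borel)
  note [measurable_cong] = M(2) sP0
  \<comment> \<open>The set is transported to \<Omega> and sandwiched with respect to the law of the
    interleaved pair under \<open>M \<Otimes>\<^sub>M P0\<close>.\<close>
  define A' where "A' = {w. (evens w, odds w) \<in> A}"
  have "A' \<in> sets B_Omega"
    unfolding A'_def by (intro A measurable_B_Omega_upgrade measurable_borel_B_Omega) measurable
  moreover have "prob_space (distr (M \<Otimes>\<^sub>M P0) borel (\<lambda>(z, w). interleave z w))"
    by (intro MP.prob_space_distr) measurable
  ultimately obtain C1 C2 where C: "C1 \<in> sets borel" "C2 \<in> sets borel" "C1 \<subseteq> A'" "A' \<subseteq> C2"
      "C2 - C1 \<in> null_sets (distr (M \<Otimes>\<^sub>M P0) borel (\<lambda>(z, w). interleave z w))"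
    by (rule B_Omega_sandwich) auto
  note [measurable] = C(1,2)
  let ?N = "{x \<in> space (M \<Otimes>\<^sub>M P0). interleave (fst x) (snd x) \<in> C2 - C1}"
  have "?N = (\<lambda>(z, w). interleave z w) -` (C2 - C1) \<inter> space (M \<Otimes>\<^sub>M P0)"
    by auto
  then have N: "?N \<in> null_sets (M \<Otimes>\<^sub>M P0)"
    using C(5) by (simp add: null_sets_distr_iff)
  \<comment> \<open>By Fubini almost every section of the gap is null. Hence the section measures of
    \<open>A\<close> agree almost everywhere with those of a Borel set, which is enough for
    measurability on the completion.\<close>
  have ae: "AE z in M. AE w in P0. interleave z w \<notin> C2 - C1"
  proof -
    have "AE x in M \<Otimes>\<^sub>M P0. interleave (fst x) (snd x) \<notin> C2 - C1"
      using AE_not_in[OF N] AE_space by eventually_elim auto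
    from MP.AE_pair[OF this] show ?thesis by simp
  qed
  have sec: "{w. interleave z w \<in> C} \<in> sets borel" if "C \<in> sets borel" for z C
    using measurable_sets[of "interleave z" borel borel C] that
    by (simp add: vimage_def measurable_Pair_compose_split)
  have "AE z in M. measure P {w. (z, w) \<in> A} = measure P0 {w. interleave z w \<in> C1}"
    using ae
  proof eventually_elim
    case (elim z)
    have sub: "{w. interleave z w \<in> C1} \<subseteq> {w. (z, w) \<in> A}" "{w. (z, w) \<in> A} \<subseteq> {w. interleave z w \<in> C2}"
      using C(3,4) by (auto simp: A'_def)
    have As: "{w. (z, w) \<in> A} \<in> sets P"
      unfolding sP by (intro A) auto
    have "measure P0 {w. interleave z w \<in> C2} = measure P0 {w. interleave z w \<in> C1}"
      using elim sec C(1-4) by (intro P0.finite_measure_eq_AE) (auto simp: sP0 elim!: eventually_mono)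
    then have "measure P {w. interleave z w \<in> C2} = measure P {w. interleave z w \<in> C1}"
      using sec C P0 by simp
    moreover have "measure P {w. interleave z w \<in> C1} \<le> measure P {w. (z, w) \<in> A}"
      by (intro P.finite_measure_mono sub As)
    moreover have "measure P {w. (z, w) \<in> A} \<le> measure P {w. interleave z w \<in> C2}"
      using sec C by (intro P.finite_measure_mono sub) (auto simp: sP borel_B_Omega)
    ultimately show ?case
      using sec C P0 by simp
  qed
  then have ae2: "AE z in completion M. measure P {w. (z, w) \<in> A} = measure P0 {w. interleave z w \<in> C1}"
    by (rule AE_completion)
  have "(\<lambda>z. measure P0 {w. interleave z w \<in> C1}) \<in> borel_measurable M"
  proof (rule P0.measurable_measure)
    have "{x \<in> space (M \<Otimes>\<^sub>M P0). interleave (fst x) (snd x) \<in> C1} \<in> sets (M \<Otimes>\<^sub>M P0)"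
      by measurable
    then show "{x \<in> space (M \<Otimes>\<^sub>M P0). snd x \<in> {w. interleave (fst x) w \<in> C1}} \<in> sets (M \<Otimes>\<^sub>M P0)"
      by simp
  qed (simp add: P0_def)
  then have g: "(\<lambda>z. measure P0 {w. interleave z w \<in> C1}) \<in> borel_measurable (completion M)"
    by (rule measurable_completion)
  show "(\<lambda>z. measure P {w. (z, w) \<in> A}) \<in> borel_measurable (completion M)"
  proof (rule measurableI)
    fix B :: "real set" assume "B \<in> sets borel"
    then have *: "(\<lambda>z. measure P0 {w. interleave z w \<in> C1}) -` B \<inter> space (completion M) \<in> sets (completion M)"
      using g by (intro measurable_sets)
    show "(\<lambda>z. measure P {w. (z, w) \<in> A}) -` B \<inter> space (completion M) \<in> sets (completion M)"
      by (rule completion.in_sets_AE[OF _ *]) (use ae2 in \<open>auto elim!: eventually_mono\<close>)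
  qed simp
qed

section \<open>Sampling from conditional laws\<close>

definition rat_enum :: "nat \<Rightarrow> real" where
  "rat_enum j = of_rat (from_nat j)"

text \<open>The bits are the Dedekind cuts of all coordinates, with the pair of coordinate and
  rational coded as one number.\<close>

definition omega_to_bits :: "omega \<Rightarrow> nat \<Rightarrow> bool" where
  "omega_to_bits w k \<longleftrightarrow> rat_enum (snd (prod_decode k)) < Rep_omega w (fst (prod_decode k))"

text \<open>A total decoder: discarding rationals outside \<open>[0,1]\<close> keeps the supremum
  bounded for every bit sequence, and the default 0 recovers a coordinate equal to 0, whose cut has
  no rational in \<open>[0,1]\<close>.\<close>

definition omega_of_bits :: "(nat \<Rightarrow> bool) \<Rightarrow> omega" where
  "omega_of_bits b = clip (\<lambda>n. SUP j. if b (prod_encode (n, j)) \<and> rat_enum j \<in> {0..1} then rat_enum j else 0)"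

lemma omega_of_bits_to_bits [simp]: "omega_of_bits (omega_to_bits w) = w"
proof -
  have key: "(SUP j. if rat_enum j < r \<and> rat_enum j \<in> {0..1} then rat_enum j else 0) = r" (is "(SUP j. ?f j) = r")
    if r: "0 \<le> r" "r \<le> 1" for r
  proof (rule antisym)
    show "(SUP j. ?f j) \<le> r"
      using r by (intro cSUP_least) auto
    have bdd: "bdd_above (range ?f)"
      by (rule bdd_aboveI[of _ 1]) auto
    show "r \<le> (SUP j. ?f j)"
    proof (rule dense_le)
      fix x assume "x < r"
      show "x \<le> (SUP j. ?f j)"
      proof (cases "r = 0")
        case True
        then show ?thesis
          using \<open>x < r\<close> r by (intro cSUP_upper2[OF bdd, of 0]) auto
      next
        case False
        then obtain u where u: "max x 0 < of_rat u" "of_rat u < r"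
          using of_rat_dense[of "max x 0" r] \<open>x < r\<close> r by auto
        then have "rat_enum (to_nat u) \<in> {0..1}" "rat_enum (to_nat u) < r" "x \<le> rat_enum (to_nat u)"
          using r unfolding rat_enum_def from_nat_to_nat by (simp_all only: atLeastAtMost_iff) linarith+
        then show ?thesis
          by (intro cSUP_upper2[OF bdd, of "to_nat u"]) simp_all
      qed
    qed
  qed
  then show ?thesis
    unfolding omega_of_bits_def omega_to_bits_def prod_encode_inverse fst_conv snd_conv
    by (simp only: key[OF Rep_omega_bounds] clip_Rep)
qed

lemma measurable_omega_to_bits [measurable]: "omega_to_bits \<in> borel \<rightarrow>\<^sub>M bits"
  unfolding measurable_bits_iff omega_to_bits_def by measurable

lemma measurable_omega_of_bits [measurable]: "omega_of_bits \<in> bits \<rightarrow>\<^sub>M borel"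
  unfolding omega_of_bits_def
proof (intro measurable_clip borel_measurable_cSUP)
  show "bdd_above ((\<lambda>j. if b (prod_encode (n, j)) \<and> rat_enum j \<in> {0..1} then rat_enum j else 0) ` UNIV)"
    for b n by (rule bdd_aboveI[of _ 1]) auto
qed (auto, measurable)

section \<open>Bit sequences with prescribed cylinder masses from one uniform variable\<close>

definition unif :: "real measure" where
  "unif = uniform_measure lborel {0..<1}"

lemma sets_unif [measurable_cong]: "sets unif = sets borel" and space_unif [simp]: "space unif = UNIV"
  by (simp_all add: unif_def)

lemma prob_space_unif: "prob_space unif"
  unfolding unif_def by (rule prob_space_uniform_measure) auto

text \<open>If \<open>q s\<close> is the probability that a random bit sequence starts with \<open>s\<close>, the intervals
  \<open>[left_end q s, left_end q s + q s)\<close> with \<open>s\<close> of a fixed length partition \<open>[0, 1)\<close> in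
  lexicographic order, and \<open>bit_path q t\<close> follows the intervals that contain \<open>t\<close>.\<close>

definition left_end :: "(bool list \<Rightarrow> real) \<Rightarrow> bool list \<Rightarrow> real" where
  "left_end q s = (\<Sum>i | i < length s \<and> s ! i. q (take i s @ [False]))"

primrec bit_path :: "(bool list \<Rightarrow> real) \<Rightarrow> real \<Rightarrow> nat \<Rightarrow> bool list" where
  "bit_path q t 0 = []"
| "bit_path q t (Suc k) = bit_path q t k @ [left_end q (bit_path q t k) + q (bit_path q t k @ [False]) \<le> t]"

text \<open>With nonnegativity, these are the conditions on the cylinder masses of a probability on
  bit sequences. Nonnegativity stays separate because the conditional probabilities below satisfy it
  everywhere, but coherence only almost everywhere.\<close>

definition coherent :: "(bool list \<Rightarrow> real) \<Rightarrow> bool" where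
  "coherent q \<longleftrightarrow> q [] = 1 \<and> (\<forall>s. q s = q (s @ [False]) + q (s @ [True]))"

lemma coherent_Nil: "coherent q \<Longrightarrow> q [] = 1"
  and coherent_split: "coherent q \<Longrightarrow> q s = q (s @ [False]) + q (s @ [True])"
  unfolding coherent_def by blast+

definition path_bits :: "(bool list \<Rightarrow> real) \<Rightarrow> real \<Rightarrow> nat \<Rightarrow> bool" where
  "path_bits q t k \<longleftrightarrow> left_end q (bit_path q t k) + q (bit_path q t k @ [False]) \<le> t"

lemma pref_path_bits: "pref k (path_bits q t) = bit_path q t k"
  by (induction k) (simp_all add: pref_Suc, simp_all add: pref_def path_bits_def)

lemma left_end_snoc: "left_end q (s @ [b]) = left_end q s + (if b then q (s @ [False]) else 0)"
proof -
  have "{i. i < length (s @ [b]) \<and> (s @ [b]) ! i} =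
      {i. i < length s \<and> s ! i} \<union> (if b then {length s} else {})"
    by (auto simp: nth_append less_Suc_eq)
  then have "left_end q (s @ [b]) =
      (\<Sum>i\<in>{i. i < length s \<and> s ! i} \<union> (if b then {length s} else {}). q (take i (s @ [b]) @ [False]))"
    by (simp add: left_end_def)
  also have "\<dots> = (\<Sum>i | i < length s \<and> s ! i. q (take i (s @ [b]) @ [False])) + (if b then q (s @ [False]) else 0)"
    by (auto simp: sum.union_disjoint)
  also have "(\<Sum>i | i < length s \<and> s ! i. q (take i (s @ [b]) @ [False])) = left_end q s"
    unfolding left_end_def by (rule sum.cong) auto
  finally show ?thesis .
qed

text \<open>Coherence splits the interval of a word into those of its two extensions, and the test
  in \<open>bit_path\<close> compares \<open>t\<close> with the splitting point.\<close>

lemma bit_path_eq_iff: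
  assumes "coherent q" "\<And>s. 0 \<le> q s" "0 \<le> t" "t < 1"
  shows "bit_path q t k = s \<longleftrightarrow> length s = k \<and> left_end q s \<le> t \<and> t < left_end q s + q s"
proof (induction k arbitrary: s)
  case 0
  then show ?case using assms coherent_Nil[of q] by (auto simp: left_end_def)
next
  case (Suc k)
  show ?case
  proof (cases s rule: rev_cases)
    case Nil
    then show ?thesis by simp
  next
    case (snoc s' b)
    have "q s' = q (s' @ [False]) + q (s' @ [True])"
      using assms(1) by (rule coherent_split)
    moreover have "bit_path q t k = s' \<longleftrightarrow> length s' = k \<and> left_end q s' \<le> t \<and> t < left_end q s' + q s'"
      by (rule Suc)
    moreover have "bit_path q t (Suc k) = s \<longleftrightarrow> bit_path q t k = s' \<and> (b \<longleftrightarrow> left_end q s' + q (s' @ [False]) \<le> t)"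
      unfolding snoc bit_path.simps by (auto simp del: not_le)
    moreover have "left_end q s = left_end q s' + (if b then q (s' @ [False]) else 0)" "length s = Suc (length s')"
      unfolding snoc by (simp_all only: left_end_snoc length_append_singleton)
    moreover have "0 \<le> q (s' @ [False])" "0 \<le> q (s' @ [True])"
      using assms(2) by auto
    ultimately show ?thesis
      unfolding snoc by (cases b) auto
  qed
qed

lemma left_end_bounds:
  assumes q: "coherent q" "\<And>s. 0 \<le> q s"
  shows "0 \<le> left_end q s" "left_end q s + q s \<le> 1"
proof -
  show "0 \<le> left_end q s"
    unfolding left_end_def using q by (intro sum_nonneg) auto
  show "left_end q s + q s \<le> 1"
  proof (induction s rule: rev_induct)
    case Nil
    then show ?case using q by (simp add: left_end_def coherent_Nil)
  next
    case (snoc b s)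
    have "q s = q (s @ [False]) + q (s @ [True])"
      using q(1) by (rule coherent_split)
    then show ?case
      using snoc q(2)[of "s @ [True]"] unfolding left_end_snoc by (cases b) auto
  qed
qed

text \<open>The word reached so far has countably many values, so each can be treated as fixed when
  the next bit is read.\<close>

lemma measurable_bit_path:
  assumes [measurable]: "\<And>s. (\<lambda>x. q x s) \<in> borel_measurable N" "t \<in> borel_measurable N"
  shows "(\<lambda>x. bit_path (q x) (t x) k) \<in> N \<rightarrow>\<^sub>M count_space UNIV"
proof (induction k)
  case (Suc k)
  have [measurable]: "(\<lambda>x. left_end (q x) s) \<in> borel_measurable N" for s
    unfolding left_end_def by measurable
  show ?case
    unfolding bit_path.simps
    by (rule measurable_compose_countable[OF _ Suc, of "\<lambda>s x. s @ [left_end (q x) s + q x (s @ [False]) \<le> t x]"]) measurable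
qed simp

text \<open>The parameters in \<open>[0,1)\<close> that lead to \<open>s\<close> form a half-open
  interval of length \<open>q s\<close>.\<close>

lemma emeasure_bit_path:
  assumes q: "coherent q" "\<And>s. 0 \<le> q s"
  shows "emeasure unif {t. bit_path q t (length s) = s} = ennreal (q s)"
proof -
  have [measurable]: "(\<lambda>t. bit_path q t k) \<in> borel \<rightarrow>\<^sub>M count_space UNIV" for k
    by (rule measurable_bit_path) auto
  have "{0..<1} \<inter> {t. bit_path q t (length s) = s} = {left_end q s..<left_end q s + q s}"
    using left_end_bounds[OF q, of s] by (auto simp: bit_path_eq_iff[OF q])
  moreover have "{t. bit_path q t (length s) = s} \<in> sets borel"
    by measurable
  ultimately show ?thesis
    using q(2) by (simp add: unif_def emeasure_uniform_measure divide_ennreal_def)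
qed

lemma measurable_path_bits:
  assumes [measurable]: "\<And>s. (\<lambda>x. q x s) \<in> borel_measurable N" "t \<in> borel_measurable N"
  shows "(\<lambda>x. path_bits (q x) (t x)) \<in> N \<rightarrow>\<^sub>M bits"
  unfolding measurable_bits_iff
proof
  fix k
  have "(\<lambda>x. last (bit_path (q x) (t x) (Suc k))) \<in> N \<rightarrow>\<^sub>M count_space UNIV"
    by (rule measurable_compose[OF measurable_bit_path]) auto
  then show "Measurable.pred N (\<lambda>x. path_bits (q x) (t x) k)"
    by (simp add: path_bits_def)
qed

section \<open>Conditional samplers and couplings\<close>

lemma space_omega_probs: "P \<in> omega_probs \<Longrightarrow> space P = UNIV"
  using sets_eq_imp_space_eq[of P B_Omega] by (auto simp: omega_probs_def)

text \<open>A randomised disintegration: if \<open>y\<close> has the law of \<open>h z\<close> and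
  \<open>t\<close> is an independent uniform variable, then \<open>(y, k z y t)\<close> has the
  joint law of \<open>(h z w, w)\<close> under \<open>P\<close>. Rectangles with Borel
  \<open>C\<close> suffice here; \<open>coupling\<close> extends this to sets in
  \<open>B_Omega\<close>.\<close>

definition cond_sampler ::
    "omega measure \<Rightarrow> (omega \<Rightarrow> omega \<Rightarrow> nat \<Rightarrow> bool) \<Rightarrow> (omega \<Rightarrow> (nat \<Rightarrow> bool) \<Rightarrow> real \<Rightarrow> omega) \<Rightarrow> bool" where
  "cond_sampler P h k \<longleftrightarrow>
     (\<lambda>(z, y, t). k z y t) \<in> B_Omega \<Otimes>\<^sub>M (bits \<Otimes>\<^sub>M borel) \<rightarrow>\<^sub>M borel \<and>
     (\<forall>z. \<forall>B\<in>sets bits. \<forall>C\<in>sets borel.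
       emeasure (distr P bits (h z) \<Otimes>\<^sub>M unif) {(y, t). y \<in> B \<and> k z y t \<in> C} =
       emeasure P {w. h z w \<in> B \<and> w \<in> C})"

text \<open>Code \<open>w\<close> by bits, take for each word the conditional probability given
  \<open>h z\<close> that the code starts with it, run \<open>path_bits\<close> on these
  probabilities and decode. The assumption on \<open>h\<close> has the form in which
  quasi-measurability on \<Omega> x \<Omega> provides it.\<close>

lemma cond_sampler_exists:
  fixes h :: "omega \<Rightarrow> omega \<Rightarrow> nat \<Rightarrow> bool"
  assumes P: "P \<in> omega_probs"
    and h: "\<And>\<phi> \<psi>. \<phi> \<in> B_Omega \<rightarrow>\<^sub>M B_Omega \<Longrightarrow> \<psi> \<in> B_Omega \<rightarrow>\<^sub>M B_Omega \<Longrightarrow>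
      (\<lambda>w. h (\<phi> w) (\<psi> w)) \<in> B_Omega \<rightarrow>\<^sub>M bits"
  shows "\<exists>k. cond_sampler P h k"
proof -
  interpret P: prob_space P using P by (simp add: omega_probs_def)
  interpret unif: prob_space unif by (rule prob_space_unif)
  have sP [measurable_cong]: "sets P = sets B_Omega" and spP [simp]: "space P = UNIV"
    using P by (simp_all add: omega_probs_def space_omega_probs)
  have hz [measurable]: "h z \<in> B_Omega \<rightarrow>\<^sub>M bits" for z
    using h[OF measurable_const[of z] measurable_ident_sets[OF refl]] by simp
  have omega_to_bits [measurable]: "omega_to_bits \<in> B_Omega \<rightarrow>\<^sub>M bits"
    by (rule measurable_borel_B_Omega) measurable
  \<comment> \<open>\<open>\<mu> z\<close> is the law of the observation and
    \<open>\<nu> s z\<close> its part on the event that the code of \<open>w\<close> starts with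
    \<open>s\<close>. The density of the second in the first is the conditional probability of that
    event.\<close>
  define \<mu> where "\<mu> z = distr P bits (h z)" for z
  define \<nu> where "\<nu> s z = distr (density P (indicator {w. omega_to_bits w \<in> cyl s})) bits (h z)" for s z
  have s\<mu> [measurable_cong]: "sets (\<mu> z) = sets bits" and s\<nu>: "sets (\<nu> s z) = sets bits" for s z
    by (simp_all add: \<mu>_def \<nu>_def)
  have e\<mu>: "emeasure (\<mu> z) B = emeasure P {w. h z w \<in> B}" if "B \<in> sets bits" for z B
    using that by (simp add: \<mu>_def emeasure_distr vimage_def)
  have [measurable]: "{w. omega_to_bits w \<in> cyl s} \<in> sets B_Omega" for s
    using measurable_sets[OF omega_to_bits sets_cyl[of s]] by (simp add: vimage_def)
  have e\<nu>: "emeasure (\<nu> s z) B = emeasure P {w. h z w \<in> B \<and> omega_to_bits w \<in> cyl s}"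
    if [measurable]: "B \<in> sets bits" for s z B
  proof -
    have [measurable]: "{w. h z w \<in> B} \<in> sets B_Omega"
      using measurable_sets[OF hz[of z] that] by (simp add: vimage_def)
    have "emeasure (\<nu> s z) B = (\<integral>\<^sup>+w. indicator {w. omega_to_bits w \<in> cyl s} w * indicator {w. h z w \<in> B} w \<partial>P)"
      by (simp add: \<nu>_def emeasure_distr emeasure_density vimage_def)
    also have "\<dots> = (\<integral>\<^sup>+w. indicator ({w. h z w \<in> B} \<inter> {w. omega_to_bits w \<in> cyl s}) w \<partial>P)"
      by (intro nn_integral_cong) (auto simp: indicator_def)
    also have "\<dots> = emeasure P ({w. h z w \<in> B} \<inter> {w. omega_to_bits w \<in> cyl s})"
      by (rule nn_integral_indicator) measurable
    finally show ?thesis by (simp add: Collect_conj_eq)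
  qed
  have p\<mu>: "prob_space (\<mu> z)" for z
    unfolding \<mu>_def by (intro P.prob_space_distr) measurable
  have m\<mu>: "(\<lambda>z. measure (\<mu> z) (cyl s)) \<in> borel_measurable B_Omega" for s
  proof -
    have "(\<lambda>z. measure P {w. (z, w) \<in> {(z, w). h z w \<in> cyl s}}) \<in> borel_measurable B_Omega"
    proof (rule measurable_measure_section[OF P])
      show "{w. (\<phi> w, \<psi> w) \<in> {(z, w). h z w \<in> cyl s}} \<in> sets B_Omega"
        if "\<phi> \<in> B_Omega \<rightarrow>\<^sub>M B_Omega" "\<psi> \<in> B_Omega \<rightarrow>\<^sub>M B_Omega" for \<phi> \<psi>
        using measurable_sets[OF h[OF that] sets_cyl[of s]] by (simp add: vimage_def)
    qed
    then show ?thesis by (simp add: measure_def e\<mu>)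
  qed
  have m\<nu>: "(\<lambda>z. measure (\<nu> s z) (cyl s')) \<in> borel_measurable B_Omega" for s s'
  proof -
    have "(\<lambda>z. measure P {w. (z, w) \<in> {(z, w). h z w \<in> cyl s' \<and> omega_to_bits w \<in> cyl s}}) \<in> borel_measurable B_Omega"
    proof (rule measurable_measure_section[OF P])
      fix \<phi> \<psi> :: "omega \<Rightarrow> omega" assume *: "\<phi> \<in> B_Omega \<rightarrow>\<^sub>M B_Omega" "\<psi> \<in> B_Omega \<rightarrow>\<^sub>M B_Omega"
      have "{w. h (\<phi> w) (\<psi> w) \<in> cyl s'} \<inter> {w. omega_to_bits (\<psi> w) \<in> cyl s} \<in> sets B_Omega"
        using measurable_sets[OF h[OF *] sets_cyl[of s']]
          measurable_sets[OF measurable_compose[OF *(2) omega_to_bits] sets_cyl[of s]]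
        by (intro sets.Int) (simp_all add: vimage_def)
      then show "{w. (\<phi> w, \<psi> w) \<in> {(z, w). h z w \<in> cyl s' \<and> omega_to_bits w \<in> cyl s}} \<in> sets B_Omega"
        by (simp add: Collect_conj_eq)
    qed
    then show ?thesis by (simp add: measure_def e\<nu>)
  qed
  define q where "q z y s = lim_ratio (\<mu> z) (\<nu> s z) y" for z y s
  have q_meas: "(\<lambda>(z, y). q z y s) \<in> borel_measurable (B_Omega \<Otimes>\<^sub>M bits)" for s
    unfolding q_def by (intro measurable_lim_ratio m\<mu> m\<nu>)
  then have [measurable]: "(\<lambda>x. q (f x) (g x) s) \<in> borel_measurable N"
    if "f \<in> N \<rightarrow>\<^sub>M B_Omega" "g \<in> N \<rightarrow>\<^sub>M bits" for f g N s
    using measurable_compose[OF measurable_Pair[OF that] q_meas] by simp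
  have q_nonneg: "0 \<le> q z y s" for z y s
    by (simp add: q_def lim_ratio_nonneg)
  have dens: "density (\<mu> z) (\<lambda>y. ennreal (q z y s)) = \<nu> s z" for z s
    unfolding q_def
  proof (intro density_lim_ratio p\<mu> s\<mu> s\<nu>)
    fix B assume B: "B \<in> sets bits"
    then have "{w. h z w \<in> B} \<in> sets P"
      using measurable_sets[OF hz[of z] B] by (simp add: vimage_def sP)
    then show "emeasure (\<nu> s z) B \<le> emeasure (\<mu> z) B"
      unfolding e\<mu>[OF B] e\<nu>[OF B] by (intro emeasure_mono) auto
  qed
  \<comment> \<open>Densities are unique only up to null sets. There are countably many words, so
    one exceptional null set serves for all of them.\<close>
  have coh: "AE y in \<mu> z. coherent (q z y)" for z
  proof -
    interpret \<mu>: prob_space "\<mu> z" by (rule p\<mu>)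
    have "AE y in \<mu> z. ennreal (q z y []) = 1"
    proof (rule \<mu>.density_unique)
      have "emeasure (\<nu> [] z) B = emeasure (\<mu> z) B" if "B \<in> sets bits" for B
        using that by (simp add: e\<mu> e\<nu> cyl_def pref_def)
      then have "\<nu> [] z = \<mu> z"
        by (intro measure_eqI) (auto simp: s\<mu> s\<nu>)
      then show "density (\<mu> z) (\<lambda>y. ennreal (q z y [])) = density (\<mu> z) (\<lambda>_. 1)"
        by (simp add: dens density_1)
    qed measurable
    moreover have "AE y in \<mu> z. \<forall>s. ennreal (q z y s) = ennreal (q z y (s @ [False]) + q z y (s @ [True]))"
      unfolding AE_all_countable
    proof
      fix s
      show "AE y in \<mu> z. ennreal (q z y s) = ennreal (q z y (s @ [False]) + q z y (s @ [True]))"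
      proof (rule \<mu>.density_unique)
        show "density (\<mu> z) (\<lambda>y. ennreal (q z y s)) =
            density (\<mu> z) (\<lambda>y. ennreal (q z y (s @ [False]) + q z y (s @ [True])))"
        proof (rule measure_eqI)
          fix B assume "B \<in> sets (density (\<mu> z) (\<lambda>y. ennreal (q z y s)))"
          then have B [measurable]: "B \<in> sets bits" by (simp add: s\<mu>)
          have [measurable]: "{w. h z w \<in> B} \<in> sets B_Omega"
            using measurable_sets[OF hz[of z] B] by (simp add: vimage_def)
          have "emeasure (density (\<mu> z) (\<lambda>y. ennreal (q z y (s @ [False]) + q z y (s @ [True])))) B =
              emeasure (density (\<mu> z) (\<lambda>y. ennreal (q z y (s @ [False])))) B +
              emeasure (density (\<mu> z) (\<lambda>y. ennreal (q z y (s @ [True])))) B"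
            by (simp add: emeasure_density q_nonneg ring_distribs nn_integral_add s\<mu>)
          also have "\<dots> = emeasure P ({w. h z w \<in> B} \<inter> {w. omega_to_bits w \<in> cyl (s @ [False])}) +
              emeasure P ({w. h z w \<in> B} \<inter> {w. omega_to_bits w \<in> cyl (s @ [True])})"
            by (simp add: dens e\<nu> Collect_conj_eq)
          also have "\<dots> = emeasure P (({w. h z w \<in> B} \<inter> {w. omega_to_bits w \<in> cyl (s @ [False])}) \<union>
              ({w. h z w \<in> B} \<inter> {w. omega_to_bits w \<in> cyl (s @ [True])}))"
            by (intro plus_emeasure) (auto simp: cyl_def)
          also have "({w. h z w \<in> B} \<inter> {w. omega_to_bits w \<in> cyl (s @ [False])}) \<union>
              ({w. h z w \<in> B} \<inter> {w. omega_to_bits w \<in> cyl (s @ [True])}) = {w. h z w \<in> B \<and> omega_to_bits w \<in> cyl s}"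
            by (auto simp: cyl_def pref_Suc)
          finally show "emeasure (density (\<mu> z) (\<lambda>y. ennreal (q z y s))) B =
              emeasure (density (\<mu> z) (\<lambda>y. ennreal (q z y (s @ [False]) + q z y (s @ [True])))) B"
            by (simp add: dens e\<nu>)
        qed simp
      qed measurable
    qed
    ultimately show ?thesis
    proof eventually_elim
      case (elim y)
      have "q z y [] = 1"
        using elim(1) by (simp add: ennreal_eq_1)
      moreover have "q z y s = q z y (s @ [False]) + q z y (s @ [True])" for s
        using elim(2)[rule_format, of s] q_nonneg ennreal_inj add_nonneg_nonneg by metis
      ultimately show ?case
        unfolding coherent_def by blast
    qed
  qed
  define b where "b z y t = path_bits (q z y) t" for z y t
  have b_meas: "(\<lambda>(z, y, t). b z y t) \<in> B_Omega \<Otimes>\<^sub>M (bits \<Otimes>\<^sub>M borel) \<rightarrow>\<^sub>M bits"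
    unfolding b_def case_prod_unfold by (intro measurable_path_bits) measurable
  have "cond_sampler P h (\<lambda>z y t. omega_of_bits (b z y t))"
    unfolding cond_sampler_def
  proof (intro conjI allI ballI)
    show "(\<lambda>(z, y, t). omega_of_bits (b z y t)) \<in> B_Omega \<Otimes>\<^sub>M (bits \<Otimes>\<^sub>M borel) \<rightarrow>\<^sub>M borel"
      using measurable_compose[OF b_meas measurable_omega_of_bits] by (simp add: case_prod_unfold)
  next
    fix z and B :: "(nat \<Rightarrow> bool) set" and C :: "omega set"
    assume B [measurable]: "B \<in> sets bits" and C [measurable]: "C \<in> sets borel"
    interpret \<mu>: prob_space "\<mu> z" by (rule p\<mu>)
    interpret \<mu>U: pair_prob_space "\<mu> z" unif ..
    have bz [measurable]: "(\<lambda>x. b z (fst x) (snd x)) \<in> bits \<Otimes>\<^sub>M borel \<rightarrow>\<^sub>M bits"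
      using measurable_compose[OF _ b_meas, of "\<lambda>x. (z, x)"] by (simp add: case_prod_unfold)
    have sp: "space (\<mu> z) = UNIV" "space (\<mu> z \<Otimes>\<^sub>M unif) = UNIV"
      by (simp_all add: \<mu>_def space_pair_measure)
    have hB [measurable]: "{w. h z w \<in> B} \<in> sets B_Omega"
      using measurable_sets[OF hz[of z] B] by (simp add: vimage_def)
    \<comment> \<open>The laws of the produced bits and of the code of \<open>w\<close>, both
      restricted to the event that the observation lies in \<open>B\<close>; they need only be
      compared on cylinders.\<close>
    let ?M1 = "distr (density (\<mu> z \<Otimes>\<^sub>M unif) (\<lambda>x. indicator B (fst x))) bits (\<lambda>x. b z (fst x) (snd x))"
    let ?M2 = "distr (density P (indicator {w. h z w \<in> B})) bits omega_to_bits"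
    have e1: "emeasure ?M1 D = emeasure (\<mu> z \<Otimes>\<^sub>M unif) {(y, t). y \<in> B \<and> b z y t \<in> D}"
      if [measurable]: "D \<in> sets bits" for D
    proof -
      let ?A = "{x. fst x \<in> B \<and> b z (fst x) (snd x) \<in> D}"
      have "{x \<in> space (\<mu> z \<Otimes>\<^sub>M unif). fst x \<in> B \<and> b z (fst x) (snd x) \<in> D} \<in> sets (\<mu> z \<Otimes>\<^sub>M unif)"
        by measurable
      then have A: "?A \<in> sets (\<mu> z \<Otimes>\<^sub>M unif)" by (simp add: sp)
      have "emeasure ?M1 D = (\<integral>\<^sup>+x. indicator B (fst x) * indicator ((\<lambda>x. b z (fst x) (snd x)) -` D) x \<partial>(\<mu> z \<Otimes>\<^sub>M unif))"
      proof -
        have v: "(\<lambda>x. b z (fst x) (snd x)) -` D \<in> sets (\<mu> z \<Otimes>\<^sub>M unif)"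
        proof -
          have "(\<lambda>x. b z (fst x) (snd x)) \<in> \<mu> z \<Otimes>\<^sub>M unif \<rightarrow>\<^sub>M bits"
            by measurable
          from measurable_sets[OF this that] show ?thesis by (simp add: sp)
        qed
        have "emeasure ?M1 D = emeasure (density (\<mu> z \<Otimes>\<^sub>M unif) (\<lambda>x. indicator B (fst x)))
            ((\<lambda>x. b z (fst x) (snd x)) -` D)"
          by (subst emeasure_distr) (auto simp: sp)
        also have "\<dots> = (\<integral>\<^sup>+x. indicator B (fst x) * indicator ((\<lambda>x. b z (fst x) (snd x)) -` D) x \<partial>(\<mu> z \<Otimes>\<^sub>M unif))"
          by (rule emeasure_density[OF _ v]) measurable
        finally show ?thesis .
      qed
      also have "\<dots> = (\<integral>\<^sup>+x. indicator ?A x \<partial>(\<mu> z \<Otimes>\<^sub>M unif))"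
        by (intro nn_integral_cong) (auto simp: indicator_def)
      also have "\<dots> = emeasure (\<mu> z \<Otimes>\<^sub>M unif) ?A"
        using A by (rule nn_integral_indicator)
      finally show ?thesis by (simp add: case_prod_unfold)
    qed
    have e2: "emeasure ?M2 D = emeasure P {w. h z w \<in> B \<and> omega_to_bits w \<in> D}"
      if [measurable]: "D \<in> sets bits" for D
    proof -
      have [measurable]: "{w. omega_to_bits w \<in> D} \<in> sets B_Omega"
        using measurable_sets[OF omega_to_bits that] by (simp add: vimage_def)
      have "emeasure ?M2 D = (\<integral>\<^sup>+w. indicator {w. h z w \<in> B} w * indicator {w. omega_to_bits w \<in> D} w \<partial>P)"
        by (simp add: emeasure_distr emeasure_density vimage_def)
      also have "\<dots> = (\<integral>\<^sup>+w. indicator ({w. h z w \<in> B} \<inter> {w. omega_to_bits w \<in> D}) w \<partial>P)"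
        by (intro nn_integral_cong) (auto simp: indicator_def)
      also have "\<dots> = emeasure P ({w. h z w \<in> B} \<inter> {w. omega_to_bits w \<in> D})"
        by (rule nn_integral_indicator) measurable
      finally show ?thesis by (simp add: Collect_conj_eq)
    qed
    have "?M2 = ?M1"
    proof (rule bits_measure_eqI)
      show "finite_measure ?M2"
        by (rule finite_measureI) (simp add: e2[OF sets.top[of bits], simplified])
      fix s
      have "{x \<in> space (\<mu> z \<Otimes>\<^sub>M unif). fst x \<in> B \<and> b z (fst x) (snd x) \<in> cyl s} \<in> sets (\<mu> z \<Otimes>\<^sub>M unif)"
        by measurable
      then have A: "{(y, t). y \<in> B \<and> b z y t \<in> cyl s} \<in> sets (\<mu> z \<Otimes>\<^sub>M unif)"
        by (simp add: sp case_prod_unfold)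
      have "emeasure ?M1 (cyl s) =
          (\<integral>\<^sup>+y. emeasure unif (Pair y -` {(y, t). y \<in> B \<and> b z y t \<in> cyl s}) \<partial>\<mu> z)"
        using A by (simp add: e1 unif.emeasure_pair_measure_alt)
      \<comment> \<open>For almost every \<open>y\<close> the masses \<open>q z y\<close> are
        coherent, and then the uniform variable selects \<open>s\<close> with probability
        \<open>q z y s\<close>.\<close>
      also have "\<dots> = (\<integral>\<^sup>+y. ennreal (q z y s) * indicator B y \<partial>\<mu> z)"
      proof (rule nn_integral_cong_AE)
        show "AE y in \<mu> z. emeasure unif (Pair y -` {(y, t). y \<in> B \<and> b z y t \<in> cyl s}) =
            ennreal (q z y s) * indicator B y"
          using coh[of z]
        proof eventually_elim
          case (elim y)
          then show ?case
            using emeasure_bit_path[OF elim q_nonneg, of s]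
            by (auto simp: b_def cyl_def pref_path_bits indicator_def vimage_def)
        qed
      qed
      also have "\<dots> = emeasure (density (\<mu> z) (\<lambda>y. ennreal (q z y s))) B"
        by (subst emeasure_density) auto
      also have "\<dots> = emeasure ?M2 (cyl s)"
        by (simp add: dens e\<nu> e2)
      finally show "emeasure ?M2 (cyl s) = emeasure ?M1 (cyl s)" ..
    qed simp_all
    \<comment> \<open>\<open>C\<close> is pulled back along the decoder, which inverts
      \<open>omega_to_bits\<close>.\<close>
    moreover have D: "omega_of_bits -` C \<in> sets bits"
      using measurable_sets[OF measurable_omega_of_bits C] by simp
    ultimately have "emeasure (\<mu> z \<Otimes>\<^sub>M unif) {(y, t). y \<in> B \<and> b z y t \<in> omega_of_bits -` C} =
        emeasure P {w. h z w \<in> B \<and> omega_to_bits w \<in> omega_of_bits -` C}"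
      using e1[OF D] e2[OF D] by simp
    then show "emeasure (distr P bits (h z) \<Otimes>\<^sub>M unif) {(y, t). y \<in> B \<and> omega_of_bits (b z y t) \<in> C} =
        emeasure P {w. h z w \<in> B \<and> w \<in> C}"
      by (simp add: \<mu>_def)
  qed
  then show ?thesis by blast
qed

text \<open>Equality on rectangles makes the pairs \<open>(Y, W)\<close> and \<open>(h w, w)\<close>
  equal in law. The second lies on the graph of \<open>h\<close>, hence so does the first almost
  surely; this is checked bit by bit.\<close>

lemma coupling:
  assumes M: "prob_space M" and P: "P \<in> omega_probs"
    and h: "h \<in> B_Omega \<rightarrow>\<^sub>M bits" and Y: "Y \<in> M \<rightarrow>\<^sub>M bits" and W: "W \<in> M \<rightarrow>\<^sub>M B_Omega"
    and rect: "\<And>B C. B \<in> sets bits \<Longrightarrow> C \<in> sets borel \<Longrightarrow>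
      emeasure M {x \<in> space M. Y x \<in> B \<and> W x \<in> C} = emeasure P {w. h w \<in> B \<and> w \<in> C}"
  shows "distr M B_Omega W = P" and "AE x in M. h (W x) = Y x"
proof -
  interpret M: prob_space M by fact
  have sP: "sets P = sets B_Omega" "space P = UNIV"
    using P by (simp_all add: omega_probs_def space_omega_probs)
  have Ms: "{x \<in> space M. Y x \<in> B \<and> W x \<in> C} \<in> sets M" if "B \<in> sets bits" "C \<in> sets B_Omega" for B C
  proof -
    have "(Y -` B \<inter> space M) \<inter> (W -` C \<inter> space M) \<in> sets M"
      using measurable_sets[OF Y that(1)] measurable_sets[OF W that(2)] by (rule sets.Int)
    also have "(Y -` B \<inter> space M) \<inter> (W -` C \<inter> space M) = {x \<in> space M. Y x \<in> B \<and> W x \<in> C}"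
      by auto
    finally show ?thesis .
  qed
  have Ps: "{w. h w \<in> B \<and> w \<in> C} \<in> sets P" if "B \<in> sets bits" "C \<in> sets B_Omega" for B C
  proof -
    have "(h -` B \<inter> space B_Omega) \<inter> C \<in> sets P"
      using measurable_sets[OF h that(1)] that(2) unfolding sP by (rule sets.Int)
    also have "(h -` B \<inter> space B_Omega) \<inter> C = {w. h w \<in> B \<and> w \<in> C}"
      by auto
    finally show ?thesis .
  qed
  \<comment> \<open>Preimages under \<open>h\<close> are only universally measurable, so the
    rectangles must be extended from Borel \<open>C\<close> by a sandwich whose gap is null for
    \<open>P\<close> and, through \<open>rect\<close>, for the law of \<open>W\<close>.\<close>
  have rect': "emeasure M {x \<in> space M. Y x \<in> B \<and> W x \<in> C} = emeasure P {w. h w \<in> B \<and> w \<in> C}"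
    if B: "B \<in> sets bits" and C: "C \<in> sets B_Omega" for B C
  proof -
    obtain C1 C2 where C12: "C1 \<in> sets borel" "C2 \<in> sets borel" "C1 \<subseteq> C" "C \<subseteq> C2" "emeasure P (C2 - C1) = 0"
      using omega_probs_sandwich[OF P C] by blast
    have "C2 - C1 \<in> sets borel"
      using C12 by auto
    from rect[OF sets.top this] have "emeasure M {x \<in> space M. W x \<in> C2 - C1} = emeasure P {w. w \<in> C2 - C1}"
      by simp
    then have "{x \<in> space M. W x \<in> C2 - C1} \<in> null_sets M"
      using Ms[of UNIV "C2 - C1"] C12 sets.top[of bits] by (simp add: null_sets_def borel_B_Omega set_diff_eq)
    then have aeM: "AE x in M. W x \<notin> C2 - C1"
      by (rule AE_I') auto
    have "C2 - C1 \<in> null_sets P"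
      using C12 by (auto simp: null_sets_def sP borel_B_Omega)
    then have aeP: "AE w in P. w \<notin> C2 - C1"
      by (rule AE_not_in)
    have "emeasure M {x \<in> space M. Y x \<in> B \<and> W x \<in> C} = emeasure M {x \<in> space M. Y x \<in> B \<and> W x \<in> C1}"
      using aeM C12 by (intro emeasure_eq_AE Ms B C) (auto elim!: eventually_mono simp: borel_B_Omega)
    also have "\<dots> = emeasure P {w. h w \<in> B \<and> w \<in> C1}"
      by (rule rect[OF B C12(1)])
    also have "\<dots> = emeasure P {w. h w \<in> B \<and> w \<in> C}"
      using aeP C12 by (intro emeasure_eq_AE Ps B C) (auto elim!: eventually_mono simp: borel_B_Omega)
    finally show ?thesis .
  qed
  show "distr M B_Omega W = P"
  proof (rule measure_eqI)
    fix C assume "C \<in> sets (distr M B_Omega W)"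
    then have C: "C \<in> sets B_Omega" by simp
    have "emeasure (distr M B_Omega W) C = emeasure M {x \<in> space M. W x \<in> C}"
      using W C by (simp add: emeasure_distr vimage_def Int_def conj_commute)
    also have "\<dots> = emeasure P C"
      using rect'[OF sets.top C] by simp
    finally show "emeasure (distr M B_Omega W) C = emeasure P C" .
  qed (simp add: sP)
  have bit: "{y. y i = c} \<in> sets bits" for i c
    using measurable_sets[OF measurable_bit, of "{c}" i] by (simp add: vimage_def)
  have hbit: "{w. h w i = c} \<in> sets B_Omega" for i c
    using measurable_sets[OF h bit[of i c]] by (simp add: vimage_def)
  have "AE x in M. \<not> (Y x i = c \<and> h (W x) i = (\<not> c))" for i c
  proof -
    have "emeasure M {x \<in> space M. Y x \<in> {y. y i = c} \<and> W x \<in> {w. h w i = (\<not> c)}} = 0"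
    proof -
      have "{w. h w \<in> {y. y i = c} \<and> w \<in> {w. h w i = (\<not> c)}} = {}"
        by auto
      then show ?thesis
        by (simp only: rect'[OF bit hbit] emeasure_empty)
    qed
    then show ?thesis
      using Ms[OF bit hbit, of i c i "\<not> c"] by (intro AE_I'[of "{x \<in> space M. Y x \<in> {y. y i = c} \<and> W x \<in> {w. h w i = (\<not> c)}}"]) (auto simp: null_sets_def)
  qed
  then have "AE x in M. \<forall>i c. \<not> (Y x i = c \<and> h (W x) i = (\<not> c))"
    unfolding AE_all_countable by blast
  then show "AE x in M. h (W x) = Y x"
    by eventually_elim (auto simp: fun_eq_iff)
qed

text \<open>The hypothesis \<open>joint\<close> says that \<open>Y\<close> has the law of
  \<open>h z\<close> and that \<open>T\<close> is uniform and independent of it. Measurability into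
  \<open>B_Omega\<close> is assumed because it arises in two ways: from a completed
  \<open>M\<close>, or from a domain carrying \<open>B_Omega\<close>.\<close>

lemma sampler_coupling:
  assumes M: "prob_space M" and P: "P \<in> omega_probs" and h: "h z \<in> B_Omega \<rightarrow>\<^sub>M bits"
    and sampler: "cond_sampler P h k"
    and Y: "Y \<in> M \<rightarrow>\<^sub>M bits" and T: "T \<in> borel_measurable M"
    and joint: "distr M (bits \<Otimes>\<^sub>M borel) (\<lambda>x. (Y x, T x)) = distr P bits (h z) \<Otimes>\<^sub>M unif"
    and W: "(\<lambda>x. k z (Y x) (T x)) \<in> M \<rightarrow>\<^sub>M B_Omega"
  shows "distr M B_Omega (\<lambda>x. k z (Y x) (T x)) = P" and "AE x in M. h z (k z (Y x) (T x)) = Y x"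
proof -
  have k: "(\<lambda>(z, y, t). k z y t) \<in> B_Omega \<Otimes>\<^sub>M (bits \<Otimes>\<^sub>M borel) \<rightarrow>\<^sub>M borel"
    using sampler by (simp add: cond_sampler_def)
  have *: "emeasure M {x \<in> space M. Y x \<in> B \<and> k z (Y x) (T x) \<in> C} = emeasure P {w. h z w \<in> B \<and> w \<in> C}"
    if [measurable]: "B \<in> sets bits" "C \<in> sets borel" for B C
  proof -
    have [measurable]: "(\<lambda>x. k z (fst x) (snd x)) \<in> bits \<Otimes>\<^sub>M borel \<rightarrow>\<^sub>M borel"
      using measurable_compose[OF _ k, of "\<lambda>x. (z, x)"] by (simp add: case_prod_unfold)
    have "{x \<in> space (bits \<Otimes>\<^sub>M borel). fst x \<in> B \<and> k z (fst x) (snd x) \<in> C} \<in> sets (bits \<Otimes>\<^sub>M (borel :: real measure))"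
      by measurable
    then have G: "{(y, t). y \<in> B \<and> k z y t \<in> C} \<in> sets (bits \<Otimes>\<^sub>M borel)"
      by (simp add: space_pair_measure case_prod_unfold)
    have "emeasure P {w. h z w \<in> B \<and> w \<in> C} =
        emeasure (distr M (bits \<Otimes>\<^sub>M borel) (\<lambda>x. (Y x, T x))) {(y, t). y \<in> B \<and> k z y t \<in> C}"
      using sampler that by (simp add: joint cond_sampler_def)
    also have "\<dots> = emeasure M ((\<lambda>x. (Y x, T x)) -` {(y, t). y \<in> B \<and> k z y t \<in> C} \<inter> space M)"
      using Y T G by (intro emeasure_distr) auto
    also have "(\<lambda>x. (Y x, T x)) -` {(y, t). y \<in> B \<and> k z y t \<in> C} \<inter> space M =
        {x \<in> space M. Y x \<in> B \<and> k z (Y x) (T x) \<in> C}"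
      by auto
    finally show ?thesis ..
  qed
  show "distr M B_Omega (\<lambda>x. k z (Y x) (T x)) = P"
    by (rule coupling(1)[OF M P h Y W *])
  show "AE x in M. h z (k z (Y x) (T x)) = Y x"
    by (rule coupling(2)[OF M P h Y W *])
qed

section \<open>Independent uniform variables\<close>

definition noise_borel :: "omega measure" where
  "noise_borel = distr (PiM UNIV (\<lambda>_. unif)) borel clip"

definition noise :: "omega measure" where
  "noise = distr (completion noise_borel) B_Omega (\<lambda>w. w)"

text \<open>Invariance of a map under \<open>trunc n\<close> expresses that it depends on the first
  \<open>n\<close> coordinates only.\<close>

definition trunc :: "nat \<Rightarrow> omega \<Rightarrow> omega" where
  "trunc n u = clip (\<lambda>i. if i < n then Rep_omega u i else 0)"

lemma Rep_trunc: "Rep_omega (trunc n u) i = (if i < n then Rep_omega u i else 0)"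
  by (simp add: trunc_def Rep_clip)

lemma measurable_trunc [measurable]: "trunc n \<in> borel \<rightarrow>\<^sub>M borel"
  unfolding trunc_def by measurable

lemma measurable_clip_PiM: "clip \<in> PiM UNIV (\<lambda>_. unif) \<rightarrow>\<^sub>M borel"
  unfolding measurable_omega_iff Rep_clip by measurable

lemma prob_space_noise_borel: "prob_space noise_borel"
  unfolding noise_borel_def
  by (intro prob_space.prob_space_distr prob_space_PiM prob_space_unif measurable_clip_PiM)

lemma sets_noise_borel [simp]: "sets noise_borel = sets borel"
  by (simp add: noise_borel_def)

lemma noise_omega_probs: "noise \<in> omega_probs"
  unfolding noise_def by (intro omega_probs_completion(1) prob_space_noise_borel sets_noise_borel)

lemma emeasure_noise: "A \<in> sets borel \<Longrightarrow> emeasure noise A = emeasure noise_borel A"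
  unfolding noise_def by (intro omega_probs_completion(2) prob_space_noise_borel sets_noise_borel)

lemma noise_borel_indep:
  assumes C [measurable]: "C \<in> sets borel" and T [measurable]: "T \<in> sets borel"
  shows "emeasure noise_borel {u. trunc n u \<in> C \<and> Rep_omega u n \<in> T} =
    emeasure noise_borel {u. trunc n u \<in> C} * emeasure unif T"
proof -
  interpret unif: prob_space unif by (rule prob_space_unif)
  interpret U: product_prob_space "\<lambda>_ :: nat. unif" UNIV ..
  let ?U = "PiM UNIV (\<lambda>_ :: nat. unif)"
  have spU: "space ?U = UNIV" by (simp add: space_PiM PiE_def)
  have "U.P.indep_vars (\<lambda>_. unif) (\<lambda>i x. x i) UNIV"
  proof (subst U.P.indep_vars_iff_distr_eq_PiM')
    show "distr ?U (PiM UNIV (\<lambda>_. unif)) (\<lambda>x. \<lambda>i\<in>UNIV. x i) = PiM UNIV (\<lambda>i. distr ?U unif (\<lambda>x. x i))"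
      by (simp add: U.PiM_component distr_id2 restrict_UNIV)
  qed auto
  from U.P.indep_var_restrict[OF this, of "{..<n}" "{n}"]
  have ind: "U.P.indep_var (PiM {..<n} (\<lambda>_. unif)) (\<lambda>x. restrict (\<lambda>i. x i) {..<n})
      (PiM {n} (\<lambda>_. unif)) (\<lambda>x. restrict (\<lambda>i. x i) {n})"
    by auto
  define g where "g x = clip (\<lambda>i. if i < n then x i else 0)" for x :: "nat \<Rightarrow> real"
  have g: "g \<in> PiM {..<n} (\<lambda>_. unif) \<rightarrow>\<^sub>M borel"
  proof -
    have "(\<lambda>x. if i < n then x i else 0) \<in> borel_measurable (PiM {..<n} (\<lambda>_. unif))" for i
      by (cases "i < n") (auto intro!: measurable_component_singleton[THEN measurable_compose] simp: sets_unif cong: measurable_cong_sets)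
    then show ?thesis
      unfolding g_def measurable_omega_iff Rep_clip by (intro allI borel_measurable_max borel_measurable_min borel_measurable_const)
  qed
  let ?c = "\<lambda>r :: real. max 0 (min 1 r)"
  let ?A = "g -` C \<inter> space (PiM {..<n} (\<lambda>_. unif))"
  let ?B = "{x \<in> space (PiM {n} (\<lambda>_. unif)). ?c (x n) \<in> T}"
  have A: "?A \<in> sets (PiM {..<n} (\<lambda>_. unif))"
    using g C by (rule measurable_sets)
  have B: "?B \<in> sets (PiM {n} (\<lambda>_. unif))"
    by measurable
  have tr: "trunc n (clip x) = g (restrict x {..<n})" for x
    by (rule Rep_omega_inject[THEN iffD1]) (auto simp: Rep_trunc g_def Rep_clip fun_eq_iff)
  have sp: "restrict x I \<in> space (PiM I (\<lambda>_. unif))" for x :: "nat \<Rightarrow> real" and I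
    by (auto simp: space_PiM)
  have vA: "{x. trunc n (clip x) \<in> C} = (\<lambda>x. restrict (\<lambda>i. x i) {..<n}) -` ?A \<inter> space ?U"
    by (auto simp: tr sp spU)
  have vB: "{x. Rep_omega (clip x) n \<in> T} = (\<lambda>x. restrict (\<lambda>i. x i) {n}) -` ?B \<inter> space ?U"
    by (auto simp: Rep_clip sp spU)
  have vAB: "{x. trunc n (clip x) \<in> C \<and> Rep_omega (clip x) n \<in> T} =
      (\<lambda>x. (restrict (\<lambda>i. x i) {..<n}, restrict (\<lambda>i. x i) {n})) -` (?A \<times> ?B) \<inter> space ?U"
    using vA vB by auto
  have nb: "emeasure noise_borel S = emeasure ?U (clip -` S)" if "S \<in> sets borel" for S
    using that measurable_clip_PiM by (simp add: noise_borel_def emeasure_distr spU)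
  have S1: "{u. trunc n u \<in> C} \<in> sets borel" and S2: "{u. Rep_omega u n \<in> T} \<in> sets borel"
    using measurable_sets[OF measurable_trunc C] measurable_sets[OF measurable_Rep_omega T]
    by (simp_all add: vimage_def)
  have "emeasure ?U {x. trunc n (clip x) \<in> C \<and> Rep_omega (clip x) n \<in> T} =
      emeasure ?U {x. trunc n (clip x) \<in> C} * emeasure ?U {x. Rep_omega (clip x) n \<in> T}"
    unfolding vAB vA vB U.P.emeasure_eq_measure U.P.indep_varD[OF ind A B]
    by (simp add: ennreal_mult)
  moreover have "emeasure ?U {x. Rep_omega (clip x) n \<in> T} = emeasure unif T"
  proof -
    have "{x. Rep_omega (clip x) n \<in> T} = (\<lambda>x. x n) -` {r. ?c r \<in> T} \<inter> space ?U"
      by (auto simp: Rep_clip spU)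
    moreover have c: "{r. ?c r \<in> T} \<in> sets unif"
      using measurable_sets[of ?c borel borel T] T by (simp add: vimage_def sets_unif)
    ultimately have "emeasure ?U {x. Rep_omega (clip x) n \<in> T} = emeasure (distr ?U unif (\<lambda>x. x n)) {r. ?c r \<in> T}"
      by (simp add: emeasure_distr)
    also have "\<dots> = emeasure unif {r. ?c r \<in> T}"
      by (simp add: U.PiM_component)
    also have "\<dots> = emeasure unif T"
    \<comment> \<open>Clamping changes nothing on \<open>[0,1)\<close>, which carries the whole mass
      of \<open>unif\<close>.\<close>
    proof (rule emeasure_eq_AE)
      have "AE r in unif. r \<in> {0..<1}"
        unfolding unif_def by (rule AE_uniform_measureI) auto
      then show "AE r in unif. r \<in> {r. ?c r \<in> T} \<longleftrightarrow> r \<in> T"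
        by eventually_elim (auto simp: max_def min_def)
    qed (use c in \<open>auto simp: sets_unif\<close>)
    finally show ?thesis .
  qed
  moreover have "emeasure noise_borel {u. trunc n u \<in> C \<and> Rep_omega u n \<in> T} =
      emeasure ?U {x. trunc n (clip x) \<in> C \<and> Rep_omega (clip x) n \<in> T}"
    using nb[OF sets.Int[OF S1 S2]] by (simp add: vimage_def Collect_conj_eq)
  moreover have "emeasure noise_borel {u. trunc n u \<in> C} = emeasure ?U {x. trunc n (clip x) \<in> C}"
    using nb[OF S1] by (simp add: vimage_def)
  ultimately show ?thesis by simp
qed

text \<open>Independence holds first for Borel events and is carried over to the universally
  measurable events of \<open>Y\<close>.\<close>

lemma noise_indep:
  assumes Y: "Y \<in> B_Omega \<rightarrow>\<^sub>M bits" and tr: "\<And>u. Y (trunc n u) = Y u"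
  shows "distr noise (bits \<Otimes>\<^sub>M borel) (\<lambda>u. (Y u, Rep_omega u n)) = distr noise bits Y \<Otimes>\<^sub>M unif"
proof -
  interpret noise: prob_space noise using noise_omega_probs by (simp add: omega_probs_def)
  interpret unif: prob_space unif by (rule prob_space_unif)
  have sn: "sets noise = sets B_Omega" "space noise = UNIV"
    using noise_omega_probs by (simp_all add: omega_probs_def space_omega_probs)
  have Y': "Y \<in> noise \<rightarrow>\<^sub>M bits"
    using Y sn(1) by (simp cong: measurable_cong_sets)
  have R: "(\<lambda>u. Rep_omega u n) \<in> borel_measurable noise"
    using measurable_borel_B_Omega[OF measurable_Rep_omega] sn(1) by (simp cong: measurable_cong_sets)
  interpret D: prob_space "distr noise bits Y"
    using Y' by (rule noise.prob_space_distr)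
  show ?thesis
  proof (rule pair_measure_eqI[symmetric])
    show "sigma_finite_measure (distr noise bits Y)" "sigma_finite_measure unif" ..
    show "sets (distr noise bits Y \<Otimes>\<^sub>M unif) = sets (distr noise (bits \<Otimes>\<^sub>M borel) (\<lambda>u. (Y u, Rep_omega u n)))"
      by (simp add: sets_unif cong: sets_pair_measure_cong)
    fix B T assume "B \<in> sets (distr noise bits Y)" "T \<in> sets unif"
    then have B: "B \<in> sets bits" and T: "T \<in> sets borel" by (simp_all add: sets_unif)
    define E where "E = {u. Y u \<in> B}"
    have E: "E \<in> sets B_Omega"
      using measurable_sets[OF Y B] by (simp add: E_def vimage_def)
    \<comment> \<open>The sandwich is taken under the law of \<open>trunc n\<close> rather than of
      the noise, so that the approximating event \<open>trunc n u \<in> C1\<close> still depends on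
      the first \<open>n\<close> coordinates only.\<close>
    have "prob_space (distr noise_borel borel (trunc n))"
      by (intro prob_space.prob_space_distr prob_space_noise_borel) (simp cong: measurable_cong_sets)
    then obtain C1 C2 where C: "C1 \<in> sets borel" "C2 \<in> sets borel" "C1 \<subseteq> E" "E \<subseteq> C2"
        "C2 - C1 \<in> null_sets (distr noise_borel borel (trunc n))"
      using B_Omega_sandwich[OF E] by (metis sets_distr)
    have spb: "space noise_borel = UNIV" using sets_eq_imp_space_eq[OF sets_noise_borel] by simp
    have tC: "{u. trunc n u \<in> S} \<in> sets borel" if "S \<in> sets borel" for S
      using measurable_sets[OF measurable_trunc that] by (simp add: vimage_def)
    have RT: "{u. Rep_omega u n \<in> T} \<in> sets borel"
      using measurable_sets[OF measurable_Rep_omega T] by (simp add: vimage_def)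
    have "emeasure noise_borel {u. trunc n u \<in> C2 - C1} = 0"
      using C(5) C(1,2) by (simp add: null_sets_def emeasure_distr spb vimage_def cong: measurable_cong_sets)
    then have "{u. trunc n u \<in> C2 - C1} \<in> null_sets noise"
      using tC[of "C2 - C1"] C(1,2) by (simp add: null_sets_def sn emeasure_noise borel_B_Omega)
    from AE_not_in[OF this] have ae: "AE u in noise. u \<in> E \<longleftrightarrow> trunc n u \<in> C1"
    proof eventually_elim
      case (elim u)
      have "u \<in> E \<longleftrightarrow> trunc n u \<in> E" by (simp add: E_def tr)
      then show ?case using elim C(3,4) by auto
    qed
    have "emeasure (distr noise (bits \<Otimes>\<^sub>M borel) (\<lambda>u. (Y u, Rep_omega u n))) (B \<times> T) =
        emeasure noise (E \<inter> {u. Rep_omega u n \<in> T})"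
      using B T Y' R by (subst emeasure_distr) (auto simp: sn E_def intro!: arg_cong[of _ _ "emeasure noise"])
    also have "\<dots> = emeasure noise ({u. trunc n u \<in> C1} \<inter> {u. Rep_omega u n \<in> T})"
      using ae E RT tC[OF C(1)] by (intro emeasure_eq_AE) (auto elim!: eventually_mono simp: sn borel_B_Omega)
    also have "\<dots> = emeasure noise_borel {u. trunc n u \<in> C1 \<and> Rep_omega u n \<in> T}"
      using RT tC[OF C(1)] by (subst emeasure_noise) (auto simp: Collect_conj_eq)
    also have "\<dots> = emeasure noise_borel {u. trunc n u \<in> C1} * emeasure unif T"
      by (rule noise_borel_indep[OF C(1) T])
    also have "emeasure noise_borel {u. trunc n u \<in> C1} = emeasure noise {u. trunc n u \<in> C1}"
      using tC[OF C(1)] by (simp add: emeasure_noise)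
    also have "\<dots> = emeasure noise E"
      using ae E tC[OF C(1)] by (intro emeasure_eq_AE) (auto elim!: eventually_mono simp: sn borel_B_Omega)
    also have "\<dots> = emeasure (distr noise bits Y) B"
      using B Y' by (simp add: emeasure_distr sn E_def vimage_def)
    finally show "emeasure (distr noise bits Y) B * emeasure unif T =
        emeasure (distr noise (bits \<Otimes>\<^sub>M borel) (\<lambda>u. (Y u, Rep_omega u n))) (B \<times> T)" ..
  qed
qed

section \<open>Extension and uniqueness for countably separated spaces\<close>

lemma const_B_Omega: "(\<lambda>_. z) \<in> B_Omega \<rightarrow>\<^sub>M B_Omega"
  by (rule measurable_const) simp

lemma ident_B_Omega: "(\<lambda>w. w) \<in> B_Omega \<rightarrow>\<^sub>M B_Omega"
  by (rule measurable_ident_sets) simp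

lemma rv_qspaceD:
  assumes "\<Xi> \<in> rvs (rv_qspace X)" "\<phi> \<in> B_Omega \<rightarrow>\<^sub>M B_Omega" "\<psi> \<in> B_Omega \<rightarrow>\<^sub>M B_Omega"
  shows "(\<lambda>w. \<Xi> (\<phi> w) (\<psi> w)) \<in> rvs X"
proof -
  have "(\<lambda>w. (\<phi> w, \<psi> w)) \<in> rvs (pair_qspace Omega Omega)"
    using assms by (simp add: pair_qspace_def Omega_def comp_def)
  then have "(\<lambda>(\<omega>, \<omega>'). \<Xi> \<omega> \<omega>') \<circ> (\<lambda>w. (\<phi> w, \<psi> w)) \<in> rvs X"
    using assms(1) unfolding rv_qspace_def quasi_measurable_def by auto
  then show ?thesis by (simp add: comp_def)
qed

lemma rv_qspaceI:
  assumes X: "quasi_universal X"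
    and *: "\<And>\<phi> \<psi>. \<phi> \<in> B_Omega \<rightarrow>\<^sub>M B_Omega \<Longrightarrow> \<psi> \<in> B_Omega \<rightarrow>\<^sub>M B_Omega \<Longrightarrow> (\<lambda>w. \<Xi> (\<phi> w) (\<psi> w)) \<in> rvs X"
  shows "\<Xi> \<in> rvs (rv_qspace X)"
proof -
  have 1: "\<Xi> z \<in> rvs X" for z
    using *[OF const_B_Omega ident_B_Omega] .
  then have "\<Xi> z w \<in> points X" for z w
    using X by (auto simp: quasi_universal_def image_subset_iff)
  moreover have "(\<lambda>(\<omega>, \<omega>'). \<Xi> \<omega> \<omega>') \<circ> \<theta> \<in> rvs X" if "\<theta> \<in> rvs (pair_qspace Omega Omega)" for \<theta>
    using *[of "fst \<circ> \<theta>" "snd \<circ> \<theta>"] that by (simp add: pair_qspace_def Omega_def comp_def case_prod_unfold)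
  ultimately show ?thesis
    using 1 by (auto simp: rv_qspace_def quasi_measurable_def)
qed

lemma rvs_prod_iff:
  "\<xi> \<in> rvs (prod_qspace I X) \<longleftrightarrow> (\<forall>w. \<xi> w \<in> extensional I) \<and> (\<forall>i\<in>I. (\<lambda>w. \<xi> w i) \<in> rvs (X i))"
  by (auto simp: prod_qspace_def)

lemma rvs_in_points: "quasi_universal X \<Longrightarrow> \<xi> \<in> rvs X \<Longrightarrow> \<xi> w \<in> points X"
  by (auto simp: quasi_universal_def image_subset_iff)

lemma quasi_measurable_restrict:
  assumes "J \<subseteq> I"
  shows "quasi_measurable (prod_qspace I X) (prod_qspace J X) (\<lambda>x. restrict x J)"
  using assms by (auto simp: quasi_measurable_def prod_qspace_def PiE_iff)

lemma measurable_restrict_prod: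
  assumes "\<And>i. quasi_universal (X i)" "J \<subseteq> I"
  shows "(\<lambda>x. restrict x J) \<in> qsigma (prod_qspace I X) \<rightarrow>\<^sub>M qsigma (prod_qspace J X)"
  using assms by (intro quasi_measurable_measurable quasi_universal_prod quasi_measurable_restrict)

lemma omega_probs_measurable:
  "P \<in> omega_probs \<Longrightarrow> f \<in> B_Omega \<rightarrow>\<^sub>M N \<Longrightarrow> f \<in> P \<rightarrow>\<^sub>M N"
  by (simp add: omega_probs_def cong: measurable_cong_sets)

section \<open>Separating bits and the uniqueness of laws on the infinite product\<close>

locale separated_qspaces =
  fixes X :: "nat \<Rightarrow> 'a qspace" and A :: "nat \<Rightarrow> nat \<Rightarrow> 'a set"
  assumes X: "\<And>i. quasi_universal (X i)"
    and A: "\<And>i j. A i j \<in> induced_sets (X i)"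
    and separates: "\<And>i x y. x \<in> points (X i) \<Longrightarrow> y \<in> points (X i) \<Longrightarrow> (\<And>j. x \<in> A i j \<longleftrightarrow> y \<in> A i j) \<Longrightarrow> x = y"
begin

text \<open>Bits of coordinates outside \<open>I\<close> are set to \<open>False\<close> rather than
  dropped, so observations of different sets of coordinates live in one space.\<close>

definition bits_on :: "nat set \<Rightarrow> (nat \<Rightarrow> 'a) \<Rightarrow> nat \<Rightarrow> bool" where
  "bits_on I x k \<longleftrightarrow> fst (prod_decode k) \<in> I \<and>
     x (fst (prod_decode k)) \<in> A (fst (prod_decode k)) (snd (prod_decode k))"

lemma measurable_bits_on:
  assumes "\<And>i. i \<in> I \<Longrightarrow> (\<lambda>w. \<xi> w i) \<in> rvs (X i)"
  shows "(\<lambda>w. bits_on I (\<xi> w)) \<in> B_Omega \<rightarrow>\<^sub>M bits"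
  unfolding measurable_bits_iff
proof
  fix k
  define i j where "i = fst (prod_decode k)" "j = snd (prod_decode k)"
  show "Measurable.pred B_Omega (\<lambda>w. bits_on I (\<xi> w) k)"
  proof (cases "i \<in> I")
    case True
    have "(\<lambda>w. \<xi> w i) -` A i j \<in> sets B_Omega"
      using A[of i j] assms[OF True] by (auto simp: induced_sets_def)
    then show ?thesis
      using True by (simp add: bits_on_def pred_def vimage_def i_j_def)
  qed (simp add: bits_on_def i_j_def)
qed

lemma measurable_bits_on_qsigma:
  assumes "J \<subseteq> I"
  shows "bits_on J \<in> qsigma (prod_qspace I X) \<rightarrow>\<^sub>M bits"
proof -
  have I: "quasi_universal (prod_qspace I X)"
    by (rule quasi_universal_prod[OF X])
  have "{x \<in> points (prod_qspace I X). bits_on J x k} \<in> induced_sets (prod_qspace I X)" for k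
  proof -
    have "\<xi> -` {x \<in> points (prod_qspace I X). bits_on J x k} \<in> sets B_Omega" if \<xi>: "\<xi> \<in> rvs (prod_qspace I X)" for \<xi>
    proof -
      have "(\<lambda>w. bits_on J (\<xi> w)) \<in> B_Omega \<rightarrow>\<^sub>M bits"
        using \<xi> assms by (intro measurable_bits_on) (auto simp: rvs_prod_iff)
      then have "Measurable.pred B_Omega (\<lambda>w. bits_on J (\<xi> w) k)"
        by (simp add: measurable_bits_iff)
      then show ?thesis
        using rvs_in_points[OF I \<xi>] by (simp add: pred_def vimage_def)
    qed
    then show ?thesis by (auto simp: induced_sets_def)
  qed
  then show ?thesis
    by (simp add: measurable_bits_iff pred_def sets_qsigma[OF I])
qed

lemma bits_on_eqD:
  assumes "bits_on I x = bits_on I y" "i \<in> I" "x i \<in> points (X i)" "y i \<in> points (X i)"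
  shows "x i = y i"
proof (rule separates[OF assms(3,4)])
  fix j
  show "x i \<in> A i j \<longleftrightarrow> y i \<in> A i j"
    using fun_cong[OF assms(1), of "prod_encode (i, j)"] assms(2) by (simp add: bits_on_def)
qed

lemma bits_on_cong: "(\<And>i. i \<in> I \<Longrightarrow> x i = y i) \<Longrightarrow> bits_on I x = bits_on I y"
  by (auto simp: bits_on_def fun_eq_iff)

text \<open>The bits of \<open>K\<close> factor through the restriction to \<open>J\<close>, so
  equal marginals on \<open>J\<close> give equal laws of bits.\<close>

lemma distr_bits_on_eq:
  assumes \<xi>: "\<xi> \<in> rvs (prod_qspace I X)" and \<xi>': "\<xi>' \<in> rvs (prod_qspace I' X)"
    and P: "P \<in> omega_probs" and P': "P' \<in> omega_probs" and J: "J \<subseteq> I" "J \<subseteq> I'" and K: "K \<subseteq> J"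
    and eq: "distr (distr P (qsigma (prod_qspace I X)) \<xi>) (qsigma (prod_qspace J X)) (\<lambda>x. restrict x J) =
      distr (distr P' (qsigma (prod_qspace I' X)) \<xi>') (qsigma (prod_qspace J X)) (\<lambda>x. restrict x J)"
  shows "distr P bits (\<lambda>w. bits_on K (\<xi> w)) = distr P' bits (\<lambda>w. bits_on K (\<xi>' w))"
proof -
  have *: "distr (distr (distr P (qsigma (prod_qspace I X)) \<xi>) (qsigma (prod_qspace J X)) (\<lambda>x. restrict x J)) bits (bits_on K)
      = distr P bits (\<lambda>w. bits_on K (\<xi> w))"
    if \<xi>: "\<xi> \<in> rvs (prod_qspace I X)" and P: "P \<in> omega_probs" and J: "J \<subseteq> I" for I P \<xi>
  proof -
    have m: "\<xi> \<in> P \<rightarrow>\<^sub>M qsigma (prod_qspace I X)"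
      using \<xi> by (intro omega_probs_measurable[OF P] rvs_measurable quasi_universal_prod X)
    have r: "(\<lambda>x. restrict x J) \<in> qsigma (prod_qspace I X) \<rightarrow>\<^sub>M qsigma (prod_qspace J X)"
      using J by (intro measurable_restrict_prod X)
    have "bits_on K \<circ> ((\<lambda>x. restrict x J) \<circ> \<xi>) = (\<lambda>w. bits_on K (\<xi> w))"
    proof
      fix w
      show "(bits_on K \<circ> ((\<lambda>x. restrict x J) \<circ> \<xi>)) w = bits_on K (\<xi> w)"
        unfolding comp_def using K by (intro bits_on_cong) auto
    qed
    then show ?thesis
      using m r measurable_bits_on_qsigma[OF K] by (simp add: distr_distr measurable_comp[OF m r])
  qed
  show ?thesis
    using *[OF \<xi> P J(1)] *[OF \<xi>' P' J(2)] eq by simp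
qed

text \<open>Equal laws of the bits alone would settle only the sets determined measurably by the
  bits. Resampling \<open>\<xi>'\<close> given the bits of \<open>\<xi>\<close> yields two points
  with the same bits, hence equal almost surely, and this settles every induced set.\<close>

lemma prob_eqI:
  assumes \<xi>: "\<xi> \<in> rvs (prod_qspace UNIV X)" and \<xi>': "\<xi>' \<in> rvs (prod_qspace UNIV X)"
    and P: "P \<in> omega_probs" and P': "P' \<in> omega_probs"
    and eq: "\<And>n. distr (distr P (qsigma (prod_qspace UNIV X)) \<xi>) (qsigma (prod_qspace {0..n} X)) (\<lambda>x. restrict x {0..n}) =
      distr (distr P' (qsigma (prod_qspace UNIV X)) \<xi>') (qsigma (prod_qspace {0..n} X)) (\<lambda>x. restrict x {0..n})"
  shows "distr P (qsigma (prod_qspace UNIV X)) \<xi> = distr P' (qsigma (prod_qspace UNIV X)) \<xi>'"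
proof -
  let ?S = "qsigma (prod_qspace UNIV X)"
  have XU: "quasi_universal (prod_qspace UNIV X)"
    by (rule quasi_universal_prod[OF X])
  interpret P: prob_space P using P by (simp add: omega_probs_def)
  interpret P': prob_space P' using P' by (simp add: omega_probs_def)
  interpret unif: prob_space unif by (rule prob_space_unif)
  interpret PU: pair_prob_space P unif ..
  have m: "(\<lambda>w. bits_on I (\<zeta> w)) \<in> B_Omega \<rightarrow>\<^sub>M bits" if "\<zeta> \<in> rvs (prod_qspace UNIV X)" for I \<zeta>
    using that by (intro measurable_bits_on) (simp add: rvs_prod_iff)
  note mP = omega_probs_measurable[OF P] and mP' = omega_probs_measurable[OF P']
  have law: "distr P bits (\<lambda>w. bits_on UNIV (\<xi> w)) = distr P' bits (\<lambda>w. bits_on UNIV (\<xi>' w))"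
  proof (rule bits_measure_eqI)
    show "finite_measure (distr P bits (\<lambda>w. bits_on UNIV (\<xi> w)))"
      using mP[OF m[OF \<xi>]] by (intro prob_space.finite_measure P.prob_space_distr)
    fix s :: "bool list"
    let ?J = "{0..length s}"
    \<comment> \<open>In the pairing of coordinates and separating sets the coordinate never exceeds
      the code, so the first \<open>length s\<close> bits involve only coordinates in
      \<open>?J\<close>.\<close>
    have c: "bits_on UNIV x \<in> cyl s \<longleftrightarrow> bits_on ?J x \<in> cyl s" for x
    proof -
      have "fst (prod_decode k) \<in> ?J" if "k < length s" for k
        using le_prod_encode_1[of "fst (prod_decode k)" "snd (prod_decode k)"] that by simp
      then have "pref (length s) (bits_on UNIV x) = pref (length s) (bits_on ?J x)"
        by (auto simp: pref_def bits_on_def)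
      then show ?thesis by (simp add: cyl_def)
    qed
    have "distr P bits (\<lambda>w. bits_on ?J (\<xi> w)) = distr P' bits (\<lambda>w. bits_on ?J (\<xi>' w))"
      by (rule distr_bits_on_eq[OF \<xi> \<xi>' P P' _ _ _ eq]) auto
    then have "emeasure (distr P bits (\<lambda>w. bits_on ?J (\<xi> w))) (cyl s) = emeasure (distr P' bits (\<lambda>w. bits_on ?J (\<xi>' w))) (cyl s)"
      by simp
    then show "emeasure (distr P bits (\<lambda>w. bits_on UNIV (\<xi> w))) (cyl s) = emeasure (distr P' bits (\<lambda>w. bits_on UNIV (\<xi>' w))) (cyl s)"
      using mP[OF m[OF \<xi>]] mP'[OF m[OF \<xi>']] by (simp add: emeasure_distr vimage_def c)
  qed simp_all
  \<comment> \<open>There is no parameter here: \<open>h\<close> ignores \<open>z\<close>, and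
    \<open>z0\<close> below is an arbitrary value for it.\<close>
  define h where "h z w = bits_on UNIV (\<xi>' w)" for z w :: omega
  have hm: "h z \<in> B_Omega \<rightarrow>\<^sub>M bits" for z
    using m[OF \<xi>'] by (simp add: h_def[abs_def])
  have "\<exists>k. cond_sampler P' h k"
  proof (rule cond_sampler_exists[OF P'])
    show "(\<lambda>w. h (\<phi> w) (\<psi> w)) \<in> B_Omega \<rightarrow>\<^sub>M bits" if "\<psi> \<in> B_Omega \<rightarrow>\<^sub>M B_Omega" for \<phi> \<psi>
      using measurable_compose[OF that hm] by (simp add: h_def)
  qed
  then obtain k where k: "cond_sampler P' h k" ..
  have k_meas: "(\<lambda>(z, y, t). k z y t) \<in> B_Omega \<Otimes>\<^sub>M (bits \<Otimes>\<^sub>M borel) \<rightarrow>\<^sub>M borel"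
    using k by (simp add: cond_sampler_def)
  define z0 :: omega where "z0 = undefined"
  \<comment> \<open>The completion turns the Borel measurable sampled point into one that is
    measurable for \<open>B_Omega\<close>.\<close>
  let ?M = "completion (P \<Otimes>\<^sub>M unif)"
  let ?Y = "\<lambda>x. bits_on UNIV (\<xi> (fst x))"
  let ?W = "\<lambda>x. k z0 (?Y x) (snd x)"
  have M: "prob_space ?M"
    by (rule PU.prob_space_completion)
  have Y: "?Y \<in> P \<Otimes>\<^sub>M unif \<rightarrow>\<^sub>M bits"
    by (rule measurable_compose[OF measurable_fst mP[OF m[OF \<xi>]]])
  have T: "snd \<in> borel_measurable (P \<Otimes>\<^sub>M unif)"
    by (simp add: sets_unif cong: measurable_cong_sets)
  have "?W \<in> P \<Otimes>\<^sub>M unif \<rightarrow>\<^sub>M borel"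
    using measurable_compose[OF _ k_meas, of "\<lambda>x. (z0, ?Y x, snd x)"] Y T by simp
  then have W: "?W \<in> ?M \<rightarrow>\<^sub>M B_Omega"
    by (intro measurable_completion_B_Omega measurable_completion PU.prob_space_axioms)
  have joint: "distr ?M (bits \<Otimes>\<^sub>M borel) (\<lambda>x. (?Y x, snd x)) = distr P' bits (h z0) \<Otimes>\<^sub>M unif"
  proof -
    have u: "distr unif borel (\<lambda>t. t) = unif"
      by (rule distr_id2) (simp add: sets_unif)
    have "distr P bits (\<lambda>w. bits_on UNIV (\<xi> w)) \<Otimes>\<^sub>M distr unif borel (\<lambda>t. t) =
        distr (P \<Otimes>\<^sub>M unif) (bits \<Otimes>\<^sub>M borel) (\<lambda>(w, t). (bits_on UNIV (\<xi> w), t))"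
    proof (rule pair_measure_distr[OF mP[OF m[OF \<xi>]]])
      show "(\<lambda>t. t) \<in> unif \<rightarrow>\<^sub>M borel" by (simp add: sets_unif cong: measurable_cong_sets)
      show "sigma_finite_measure (distr unif borel (\<lambda>t. t))"
        unfolding u ..
    qed
    also have "\<dots> = distr ?M (bits \<Otimes>\<^sub>M borel) (\<lambda>x. (?Y x, snd x))"
      using Y T by (subst distr_completion) (auto simp: case_prod_unfold)
    finally show ?thesis
      by (simp add: u law h_def[abs_def])
  qed
  note tr = sampler_coupling[where h = h and k = k and z = z0, OF M P' hm[of z0] k measurable_completion[OF Y] measurable_completion[OF T] joint W]
  have m\<xi>: "\<xi> \<in> P \<rightarrow>\<^sub>M ?S" and m\<xi>': "\<xi>' \<in> B_Omega \<rightarrow>\<^sub>M ?S"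
    using \<xi> \<xi>' by (auto intro!: mP rvs_measurable XU)
  have mf: "(\<lambda>x. \<xi> (fst x)) \<in> P \<Otimes>\<^sub>M unif \<rightarrow>\<^sub>M ?S"
    by (rule measurable_compose[OF measurable_fst m\<xi>])
  have "distr P ?S \<xi> = distr (distr (P \<Otimes>\<^sub>M unif) P fst) ?S \<xi>"
    by (simp add: unif.distr_pair_fst)
  also have "\<dots> = distr (P \<Otimes>\<^sub>M unif) ?S (\<lambda>x. \<xi> (fst x))"
    using m\<xi> by (simp add: distr_distr comp_def)
  also have "\<dots> = distr ?M ?S (\<lambda>x. \<xi> (fst x))"
    using mf by (simp add: distr_completion)
  also have "\<dots> = distr ?M ?S (\<lambda>x. \<xi>' (?W x))"
  proof (rule distr_cong_AE)
    show "AE x in ?M. \<xi> (fst x) = \<xi>' (?W x)"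
      using tr(2)
    proof eventually_elim
      case (elim x)
      have "\<xi> (fst x) i \<in> points (X i)" "\<xi>' (?W x) i \<in> points (X i)" for i
        using \<xi> \<xi>' by (auto simp: rvs_prod_iff intro: rvs_in_points[OF X])
      then have "\<xi>' (?W x) i = \<xi> (fst x) i" for i
        using elim by (intro bits_on_eqD[of UNIV]) (auto simp: h_def)
      then show ?case by auto
    qed
    show "(\<lambda>x. \<xi> (fst x)) \<in> ?M \<rightarrow>\<^sub>M ?S"
      using mf by (rule measurable_completion)
    show "(\<lambda>x. \<xi>' (?W x)) \<in> ?M \<rightarrow>\<^sub>M ?S"
      by (rule measurable_compose[OF W m\<xi>'])
  qed simp_all
  also have "\<dots> = distr (distr ?M B_Omega ?W) ?S \<xi>'"
    using W m\<xi>' by (simp add: distr_distr comp_def)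
  finally show ?thesis
    by (simp add: tr(1))
qed

text \<open>Stage \<open>n\<close> has set the coordinates below \<open>n\<close>; the next one uses
  only their bits and the fresh uniform variable number \<open>n\<close>. The value
  \<open>undefined\<close> elsewhere follows the extensional convention of
  \<open>prod_qspace\<close>, so a whole stage can equal a value of \<open>\<Xi>\<close>.\<close>

primrec chain :: "(nat \<Rightarrow> omega \<Rightarrow> omega \<Rightarrow> nat \<Rightarrow> 'a) \<Rightarrow> (nat \<Rightarrow> omega \<Rightarrow> (nat \<Rightarrow> bool) \<Rightarrow> real \<Rightarrow> omega) \<Rightarrow>
    omega \<Rightarrow> omega \<Rightarrow> nat \<Rightarrow> nat \<Rightarrow> 'a" where
  "chain \<Xi> k z u 0 = (\<lambda>_. undefined)"
| "chain \<Xi> k z u (Suc n) = (chain \<Xi> k z u n)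
     (n := \<Xi> n z (k n z (bits_on {..<n} (chain \<Xi> k z u n)) (Rep_omega u n)) n)"

lemma chain_eq: "i < n \<Longrightarrow> chain \<Xi> k z u n i = chain \<Xi> k z u (Suc i) i"
  by (induction n) (auto simp: less_Suc_eq)

lemma chain_undefined: "n \<le> i \<Longrightarrow> chain \<Xi> k z u n i = undefined"
  by (induction n) auto

lemma chain_trunc: "n \<le> m \<Longrightarrow> chain \<Xi> k z (trunc m u) n = chain \<Xi> k z u n"
  by (induction n) (auto simp: Rep_trunc)

text \<open>One noise law serves all \<open>z\<close>, and the parameter enters only through the
  sampled path, as admissibility in \<open>prob_qspace\<close> requires.\<close>

lemma extension_exists:
  assumes \<Xi>: "\<And>n. \<Xi> n \<in> rvs (rv_qspace (prod_qspace {0..n} X))" and P: "\<And>n. P n \<in> omega_probs"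
    and consistent: "\<And>n z. distr (distr (P (Suc n)) (qsigma (prod_qspace {0..Suc n} X)) (\<Xi> (Suc n) z))
        (qsigma (prod_qspace {0..n} X)) (\<lambda>x. restrict x {0..n}) =
      distr (P n) (qsigma (prod_qspace {0..n} X)) (\<Xi> n z)"
  shows "\<exists>\<Psi>\<in>rvs (rv_qspace (prod_qspace UNIV X)). \<exists>\<Lambda>\<in>omega_probs. \<forall>n z.
    distr (distr \<Lambda> (qsigma (prod_qspace UNIV X)) (\<Psi> z)) (qsigma (prod_qspace {0..n} X)) (\<lambda>x. restrict x {0..n}) =
    distr (P n) (qsigma (prod_qspace {0..n} X)) (\<Xi> n z)"
proof -
  have XI: "quasi_universal (prod_qspace I X)" for I
    by (rule quasi_universal_prod[OF X])
  have \<Xi>z: "\<Xi> n z \<in> rvs (prod_qspace {0..n} X)" for n z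
    using \<Xi>[of n] by (auto simp: rv_qspace_def)
  define h where "h n z w = bits_on {..<n} (\<Xi> n z w)" for n z w
  have h: "(\<lambda>w. h n (\<phi> w) (\<psi> w)) \<in> B_Omega \<rightarrow>\<^sub>M bits"
    if "\<phi> \<in> B_Omega \<rightarrow>\<^sub>M B_Omega" "\<psi> \<in> B_Omega \<rightarrow>\<^sub>M B_Omega" for n \<phi> \<psi>
    unfolding h_def using rv_qspaceD[OF \<Xi> that] by (intro measurable_bits_on) (simp add: rvs_prod_iff)
  have hz: "h n z \<in> B_Omega \<rightarrow>\<^sub>M bits" for n z
    using h[OF const_B_Omega ident_B_Omega] .
  have "\<forall>n. \<exists>k. cond_sampler (P n) (h n) k"
    by (intro allI cond_sampler_exists P h)
  then obtain k where k: "\<And>n. cond_sampler (P n) (h n) (k n)"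
    by (auto dest!: choice)
  then have k1: "(\<lambda>(z, y, t). k n z y t) \<in> B_Omega \<Otimes>\<^sub>M (bits \<Otimes>\<^sub>M borel) \<rightarrow>\<^sub>M borel" for n
    by (simp add: cond_sampler_def)
  let ?c = "chain \<Xi> k"
  have k_meas: "(\<lambda>w. k n (\<phi> w) (y w) (Rep_omega (\<psi> w) n)) \<in> B_Omega \<rightarrow>\<^sub>M B_Omega"
    if "\<phi> \<in> B_Omega \<rightarrow>\<^sub>M B_Omega" "\<psi> \<in> B_Omega \<rightarrow>\<^sub>M B_Omega" "y \<in> B_Omega \<rightarrow>\<^sub>M bits" for n \<phi> \<psi> y
  proof (rule measurable_B_Omega_upgrade)
    have "(\<lambda>w. Rep_omega (\<psi> w) n) \<in> borel_measurable B_Omega"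
      by (rule measurable_compose[OF that(2) measurable_borel_B_Omega[OF measurable_Rep_omega]])
    then show "(\<lambda>w. k n (\<phi> w) (y w) (Rep_omega (\<psi> w) n)) \<in> B_Omega \<rightarrow>\<^sub>M borel"
      using measurable_compose[OF _ k1[of n], of "\<lambda>w. (\<phi> w, y w, Rep_omega (\<psi> w) n)"] that by simp
  qed
  \<comment> \<open>The induction runs along arbitrary reparametrisations of both arguments, since
    that is what \<open>rv_qspaceI\<close> asks for.\<close>
  have c_rv: "(\<lambda>w. ?c (\<phi> w) (\<psi> w) n i) \<in> rvs (X i)"
    if \<phi>\<psi>: "\<phi> \<in> B_Omega \<rightarrow>\<^sub>M B_Omega" "\<psi> \<in> B_Omega \<rightarrow>\<^sub>M B_Omega" and "i < n" for \<phi> \<psi> n i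
    using \<open>i < n\<close>
  proof (induction n arbitrary: i)
    case (Suc n)
    show ?case
    proof (cases "i = n")
      case True
      let ?k = "\<lambda>w. k n (\<phi> w) (bits_on {..<n} (?c (\<phi> w) (\<psi> w) n)) (Rep_omega (\<psi> w) n)"
      have "(\<lambda>w. bits_on {..<n} (?c (\<phi> w) (\<psi> w) n)) \<in> B_Omega \<rightarrow>\<^sub>M bits"
        using Suc.IH by (intro measurable_bits_on) simp
      then have "?k \<in> B_Omega \<rightarrow>\<^sub>M B_Omega"
        by (intro k_meas \<phi>\<psi>)
      then have "(\<lambda>w. \<Xi> n (\<phi> w) (?k w)) \<in> rvs (prod_qspace {0..n} X)"
        by (intro rv_qspaceD[OF \<Xi>] \<phi>\<psi>)
      then show ?thesis
        using True by (simp add: rvs_prod_iff)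
    next
      case False
      then show ?thesis using Suc by simp
    qed
  qed simp
  \<comment> \<open>Coordinate \<open>i\<close> is final from stage \<open>Suc i\<close> on.\<close>
  define \<Psi> where "\<Psi> z u i = ?c z u (Suc i) i" for z u i
  have \<Psi>: "\<Psi> \<in> rvs (rv_qspace (prod_qspace UNIV X))"
  proof (rule rv_qspaceI[OF XI])
    show "(\<lambda>w. \<Psi> (\<phi> w) (\<psi> w)) \<in> rvs (prod_qspace UNIV X)"
      if "\<phi> \<in> B_Omega \<rightarrow>\<^sub>M B_Omega" "\<psi> \<in> B_Omega \<rightarrow>\<^sub>M B_Omega" for \<phi> \<psi>
      unfolding rvs_prod_iff \<Psi>_def using c_rv[OF that] by (auto simp del: chain.simps)
  qed
  have c_points: "?c z u n i \<in> points (X i)" if "i < n" for z u n i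
    using rvs_in_points[OF X c_rv[OF const_B_Omega ident_B_Omega that]] .
  have restr: "restrict (\<Psi> z u) {0..n} = ?c z u (Suc n)" for z u n
  proof
    fix i
    show "restrict (\<Psi> z u) {0..n} i = ?c z u (Suc n) i"
      using chain_eq[of i "Suc n" \<Xi> k z u] chain_undefined[of "Suc n" i \<Xi> k z u]
      by (auto simp: \<Psi>_def simp del: chain.simps)
  qed
  interpret noise: prob_space noise
    using noise_omega_probs by (simp add: omega_probs_def)
  note mn = omega_probs_measurable[OF noise_omega_probs]
  define Y where "Y n z u = bits_on {..<n} (?c z u n)" for n z u
  define W where "W n z u = k n z (Y n z u) (Rep_omega u n)" for n z u
  have Ym: "Y n z \<in> B_Omega \<rightarrow>\<^sub>M bits" for n z
    unfolding Y_def using c_rv[OF const_B_Omega ident_B_Omega] by (intro measurable_bits_on) simp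
  have Wm: "W n z \<in> B_Omega \<rightarrow>\<^sub>M B_Omega" for n z
    unfolding W_def using k_meas[OF const_B_Omega ident_B_Omega Ym] .
  \<comment> \<open>If the bits of the earlier coordinates have the right law, the sampled point has
    law \<open>P n\<close> and its image under \<open>\<Xi> n z\<close> is almost surely the next
    stage: bits settle the coordinates below \<open>n\<close>, the definition of
    \<open>chain\<close> settles \<open>n\<close>, and both sides are \<open>undefined\<close>
    beyond.\<close>
  have step: "distr noise B_Omega (W n z) = P n \<and> (AE u in noise. ?c z u (Suc n) = \<Xi> n z (W n z u))"
    if law: "distr noise bits (Y n z) = distr (P n) bits (h n z)" for n z
  proof -
    have joint: "distr noise (bits \<Otimes>\<^sub>M borel) (\<lambda>u. (Y n z u, Rep_omega u n)) = distr (P n) bits (h n z) \<Otimes>\<^sub>M unif"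
      unfolding law[symmetric] by (rule noise_indep[OF Ym]) (simp add: Y_def chain_trunc)
    note tr = sampler_coupling[where h = "h n" and k = "k n" and z = z, OF noise.prob_space_axioms P hz k mn[OF Ym]
        mn[OF measurable_borel_B_Omega[OF measurable_Rep_omega]] joint mn[OF Wm[of n z, unfolded W_def[abs_def]]]]
    have "AE u in noise. ?c z u (Suc n) = \<Xi> n z (W n z u)"
      using tr(2)
    proof eventually_elim
      case (elim u)
      have pts: "\<Xi> n z (W n z u) i \<in> points (X i)" if "i \<le> n" for i
        using \<Xi>z[of n z] that by (auto simp: rvs_prod_iff intro: rvs_in_points[OF X])
      have "?c z u n i = \<Xi> n z (W n z u) i" if "i < n" for i
        using elim that pts[of i] c_points[OF that] by (intro bits_on_eqD[of "{..<n}"]) (auto simp: h_def Y_def W_def)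
      moreover have "\<Xi> n z (W n z u) i = undefined" if "i > n" for i
        using \<Xi>z[of n z] that by (auto simp: rvs_prod_iff extensional_def)
      ultimately show ?case
        using chain_undefined[of n _ \<Xi> k z u]
        by (auto simp: fun_eq_iff W_def Y_def) (metis linorder_neqE_nat less_imp_le)
    qed
    then show ?thesis
      using tr(1) by (simp add: W_def[abs_def])
  qed
  have law: "distr noise bits (Y n z) = distr (P n) bits (h n z)" for n z
  proof (induction n)
    case 0
    interpret P0: prob_space "P 0" using P by (simp add: omega_probs_def)
    \<comment> \<open>No coordinate lies below 0, so both observations are constant.\<close>
    have "Y 0 z = (\<lambda>_ _. False)" "h 0 z = (\<lambda>_ _. False)"
      by (simp_all add: Y_def h_def bits_on_def fun_eq_iff)
    then show ?case by simp
  next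
    case (Suc n)
    note st = step[OF Suc]
    have b: "(\<lambda>w. bits_on {..<Suc n} (\<Xi> n z w)) \<in> B_Omega \<rightarrow>\<^sub>M bits"
      using \<Xi>z[of n z] by (intro measurable_bits_on) (simp add: rvs_prod_iff)
    have "distr noise bits (Y (Suc n) z) = distr noise bits (\<lambda>u. bits_on {..<Suc n} (\<Xi> n z (W n z u)))"
      using st by (intro distr_cong_AE mn Ym measurable_compose[OF Wm b])
        (auto elim!: eventually_mono simp: Y_def simp del: chain.simps)
    also have "\<dots> = distr (distr noise B_Omega (W n z)) bits (\<lambda>w. bits_on {..<Suc n} (\<Xi> n z w))"
      using mn[OF Wm] b by (simp add: distr_distr comp_def)
    also have "\<dots> = distr (P n) bits (\<lambda>w. bits_on {..<Suc n} (\<Xi> n z w))"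
      using st by simp
    \<comment> \<open>Consistency enters here: the coordinates below \<open>Suc n\<close> are those
      in \<open>{0..n}\<close>, on which levels \<open>n\<close> and \<open>Suc n\<close> have the
      same marginal.\<close>
    also have "\<dots> = distr (P (Suc n)) bits (\<lambda>w. bits_on {..<Suc n} (\<Xi> (Suc n) z w))"
    proof (rule distr_bits_on_eq[OF \<Xi>z \<Xi>z P P, of "{0..n}"])
      have "distr (distr (P n) (qsigma (prod_qspace {0..n} X)) (\<Xi> n z)) (qsigma (prod_qspace {0..n} X)) (\<lambda>x. restrict x {0..n}) =
          distr (P n) (qsigma (prod_qspace {0..n} X)) (\<lambda>w. restrict (\<Xi> n z w) {0..n})"
        using omega_probs_measurable[OF P rvs_measurable[OF XI \<Xi>z]] measurable_restrict_prod[OF X, of "{0..n}" "{0..n}"]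
        by (simp add: distr_distr comp_def)
      also have "(\<lambda>w. restrict (\<Xi> n z w) {0..n}) = \<Xi> n z"
        using \<Xi>z[of n z] by (auto simp: rvs_prod_iff extensional_restrict)
      finally show "distr (distr (P n) (qsigma (prod_qspace {0..n} X)) (\<Xi> n z)) (qsigma (prod_qspace {0..n} X)) (\<lambda>x. restrict x {0..n}) =
        distr (distr (P (Suc n)) (qsigma (prod_qspace {0..Suc n} X)) (\<Xi> (Suc n) z)) (qsigma (prod_qspace {0..n} X)) (\<lambda>x. restrict x {0..n})"
        by (simp only: consistent)
    qed auto
    finally show ?case by (simp add: h_def[abs_def])
  qed
  have "distr (distr noise (qsigma (prod_qspace UNIV X)) (\<Psi> z)) (qsigma (prod_qspace {0..n} X)) (\<lambda>x. restrict x {0..n}) =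
    distr (P n) (qsigma (prod_qspace {0..n} X)) (\<Xi> n z)" for n z
  proof -
    note st = step[OF law, of n z]
    have \<Psi>z: "\<Psi> z \<in> rvs (prod_qspace UNIV X)"
      using \<Psi> by (auto simp: rv_qspace_def)
    have m: "\<Psi> z \<in> noise \<rightarrow>\<^sub>M qsigma (prod_qspace UNIV X)"
      by (intro mn rvs_measurable XI \<Psi>z)
    have r: "(\<lambda>x. restrict x {0..n}) \<in> qsigma (prod_qspace UNIV X) \<rightarrow>\<^sub>M qsigma (prod_qspace {0..n} X)"
      by (intro measurable_restrict_prod X) simp
    have \<Xi>m: "\<Xi> n z \<in> B_Omega \<rightarrow>\<^sub>M qsigma (prod_qspace {0..n} X)"
      by (intro rvs_measurable XI \<Xi>z)
    have "distr (distr noise (qsigma (prod_qspace UNIV X)) (\<Psi> z)) (qsigma (prod_qspace {0..n} X)) (\<lambda>x. restrict x {0..n}) =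
        distr noise (qsigma (prod_qspace {0..n} X)) (\<lambda>u. restrict (\<Psi> z u) {0..n})"
      using m r by (simp add: distr_distr comp_def)
    also have "\<dots> = distr noise (qsigma (prod_qspace {0..n} X)) (\<lambda>u. \<Xi> n z (W n z u))"
      using st by (intro distr_cong_AE measurable_compose[OF m r] measurable_compose[OF mn[OF Wm] \<Xi>m])
        (auto elim!: eventually_mono simp: restr simp del: chain.simps)
    also have "\<dots> = distr (distr noise B_Omega (W n z)) (qsigma (prod_qspace {0..n} X)) (\<Xi> n z)"
      using mn[OF Wm] \<Xi>m by (simp add: distr_distr comp_def)
    finally show ?thesis
      using st by simp
  qed
  then show ?thesis
    using \<Psi> noise_omega_probs by blast
qed

end

section \<open>From parameters in \<Omega> to a standard parameter space\<close>

theorem theorem7p32: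
  fixes X :: "nat \<Rightarrow> 'a qspace"
    and Z :: "'z qspace"
    and Q :: "nat \<Rightarrow> 'z \<Rightarrow> (nat \<Rightarrow> 'a) measure"
  assumes "\<And>n. quasi_universal (X n)"
    and "\<And>n. countably_separated (X n)"
    and "quasi_universal Z"
    and "standard_qspace Z"
    and "\<And>n. Q n \<in> qmaps Z (prob_qspace (prod_qspace {0..n} X))"
    and "\<And>n z. z \<in> points Z \<Longrightarrow>
      distr (Q (Suc n) z) (qsigma (prod_qspace {0..n} X)) (\<lambda>x. restrict x {0..n}) = Q n z"
  shows "\<exists>!K. K \<in> qmaps Z (prob_qspace (prod_qspace UNIV X)) \<and>
    (\<forall>n. \<forall>z\<in>points Z.
      distr (K z) (qsigma (prod_qspace {0..n} X)) (\<lambda>x. restrict x {0..n}) = Q n z)"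
proof -
  let ?PU = "prob_qspace (prod_qspace UNIV X)"
  have "\<exists>A :: nat \<Rightarrow> 'a set. (\<forall>j. A j \<in> induced_sets (X i)) \<and>
    (\<forall>x\<in>points (X i). \<forall>y\<in>points (X i). (\<forall>j. x \<in> A j \<longleftrightarrow> y \<in> A j) \<longrightarrow> x = y)" for i
  proof -
    obtain C where C: "countable C" "C \<subseteq> induced_sets (X i)"
      "\<forall>x\<in>points (X i). \<forall>y\<in>points (X i). x \<noteq> y \<longrightarrow> (\<exists>A\<in>C. (x \<in> A) \<noteq> (y \<in> A))"
      using assms(2)[of i] unfolding countably_separated_def by (elim exE conjE)
    \<comment> \<open>The empty set is added so that there is something to enumerate even when
      \<open>C\<close> is empty; it separates nothing.\<close>
    let ?A = "from_nat_into (insert {} C)"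
    have range: "range ?A = insert {} C"
      using C(1) by (intro range_from_nat_into) auto
    have "{} \<in> induced_sets (X i)"
      by (auto simp: induced_sets_def)
    then have "?A j \<in> induced_sets (X i)" for j
      using range C(2) by (metis insert_subset range_subsetD)
    moreover have "x = y" if xy: "x \<in> points (X i)" "y \<in> points (X i)" "\<forall>j. x \<in> ?A j \<longleftrightarrow> y \<in> ?A j" for x y
    proof (rule ccontr)
      assume "x \<noteq> y"
      then obtain B where B: "B \<in> C" "(x \<in> B) \<noteq> (y \<in> B)" using C(3) xy by blast
      then obtain j where "B = ?A j" using range by (metis insertI2 rangeE)
      then show False using B xy by blast
    qed
    ultimately show ?thesis by blast
  qed
  then obtain A :: "nat \<Rightarrow> nat \<Rightarrow> 'a set" where
    A: "\<And>i j. A i j \<in> induced_sets (X i)"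
      "\<And>i x y. x \<in> points (X i) \<Longrightarrow> y \<in> points (X i) \<Longrightarrow> (\<And>j. x \<in> A i j \<longleftrightarrow> y \<in> A i j) \<Longrightarrow> x = y"
    by metis
  interpret separated_qspaces X A
    using assms(1) A by unfold_locales blast+
  have XU: "quasi_universal (prod_qspace I X)" for I
    by (intro quasi_universal_prod X)
  have unique: "K = K'"
    if K: "K \<in> qmaps Z ?PU" "K' \<in> qmaps Z ?PU"
      and eq: "\<And>n z. z \<in> points Z \<Longrightarrow>
        distr (K z) (qsigma (prod_qspace {0..n} X)) (\<lambda>x. restrict x {0..n}) =
        distr (K' z) (qsigma (prod_qspace {0..n} X)) (\<lambda>x. restrict x {0..n})" for K K'
  proof (rule extensionalityI)
    show "K \<in> extensional (points Z)" "K' \<in> extensional (points Z)"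
      using K by (auto simp: qmaps_def)
    fix z assume z: "z \<in> points Z"
    then have "K z \<in> points ?PU" "K' z \<in> points ?PU"
      using K by (auto simp: qmaps_def quasi_measurable_def)
    then obtain \<xi> P \<xi>' P' where *: "K z = distr P (qsigma (prod_qspace UNIV X)) \<xi>" "\<xi> \<in> rvs (prod_qspace UNIV X)"
        "P \<in> omega_probs" "K' z = distr P' (qsigma (prod_qspace UNIV X)) \<xi>'" "\<xi>' \<in> rvs (prod_qspace UNIV X)" "P' \<in> omega_probs"
      by (auto simp: prob_qspace_def)
    show "K z = K' z"
      using eq[OF z] unfolding *(1,4) by (intro prob_eqI *)
  qed
  have "\<exists>K. K \<in> qmaps Z ?PU \<and> (\<forall>n. \<forall>z\<in>points Z.
      distr (K z) (qsigma (prod_qspace {0..n} X)) (\<lambda>x. restrict x {0..n}) = Q n z)"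
  proof (cases "points Z = {}")
    \<comment> \<open>Without points \<open>Z\<close> has no admissible random variables, and the
      everywhere undefined map is the only extensional one.\<close>
    case True
    then have "rvs Z = {}"
      using assms(3) by (auto simp: quasi_universal_def)
    then show ?thesis
      using True by (intro exI[of _ "\<lambda>_. undefined"]) (auto simp: qmaps_def quasi_measurable_def)
  next
    case False
    then obtain i r where i: "quasi_measurable Z Omega i" and r: "quasi_measurable Omega Z r"
      and ri: "\<And>z. z \<in> points Z \<Longrightarrow> r (i z) = z"
      using assms(4) by (auto simp: standard_qspace_def)
    have "(\<lambda>w. w) \<in> rvs Omega"
      by (simp add: Omega_def ident_B_Omega)
    \<comment> \<open>The identity is admissible on \<Omega>, so the retraction is itself a random
      variable of \<open>Z\<close>. Thus each \<open>Q n \<circ> r\<close> is given by a single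
      family \<open>\<Xi> n\<close> and a single probability \<open>P n\<close>.\<close>
    with r have "r \<circ> (\<lambda>w. w) \<in> rvs Z"
      unfolding quasi_measurable_def by blast
    then have "r \<in> rvs Z"
      by (simp add: comp_def)
    then have rZ: "r w \<in> points Z" for w
      by (rule rvs_in_points[OF assms(3)])
    have "Q n \<circ> r \<in> rvs (prob_qspace (prod_qspace {0..n} X))" for n
      using assms(5)[of n] \<open>r \<in> rvs Z\<close> by (auto simp: qmaps_def quasi_measurable_def)
    then have "\<forall>n. \<exists>\<Xi> P. \<Xi> \<in> rvs (rv_qspace (prod_qspace {0..n} X)) \<and> P \<in> omega_probs \<and>
        Q n \<circ> r = (\<lambda>w. distr P (qsigma (prod_qspace {0..n} X)) (\<Xi> w))"
      by (simp only: prob_qspace_def qspace.simps mem_Collect_eq) blast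
    from choice[OF this] obtain \<Xi> where "\<forall>n. \<exists>P. \<Xi> n \<in> rvs (rv_qspace (prod_qspace {0..n} X)) \<and> P \<in> omega_probs \<and>
        Q n \<circ> r = (\<lambda>w. distr P (qsigma (prod_qspace {0..n} X)) (\<Xi> n w))" ..
    from choice[OF this] obtain P where "\<forall>n. \<Xi> n \<in> rvs (rv_qspace (prod_qspace {0..n} X)) \<and> P n \<in> omega_probs \<and>
        Q n \<circ> r = (\<lambda>w. distr (P n) (qsigma (prod_qspace {0..n} X)) (\<Xi> n w))" ..
    then have \<Xi>: "\<Xi> n \<in> rvs (rv_qspace (prod_qspace {0..n} X))" and P: "P n \<in> omega_probs"
      and Q: "Q n \<circ> r = (\<lambda>w. distr (P n) (qsigma (prod_qspace {0..n} X)) (\<Xi> n w))" for n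
      by simp_all
    have Qr: "Q n (r w) = distr (P n) (qsigma (prod_qspace {0..n} X)) (\<Xi> n w)" for n w
      using fun_cong[OF Q, of n w] by simp
    have "distr (distr (P (Suc n)) (qsigma (prod_qspace {0..Suc n} X)) (\<Xi> (Suc n) w))
          (qsigma (prod_qspace {0..n} X)) (\<lambda>x. restrict x {0..n}) =
        distr (P n) (qsigma (prod_qspace {0..n} X)) (\<Xi> n w)" for n w
      using assms(6)[OF rZ] by (simp only: Qr)
    note ext = extension_exists[of \<Xi> P, OF \<Xi> P this]
    obtain \<Psi> \<Lambda> where \<Psi>: "\<Psi> \<in> rvs (rv_qspace (prod_qspace UNIV X))" and \<Lambda>: "\<Lambda> \<in> omega_probs"
      and marg: "\<And>n w. distr (distr \<Lambda> (qsigma (prod_qspace UNIV X)) (\<Psi> w)) (qsigma (prod_qspace {0..n} X))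
          (\<lambda>x. restrict x {0..n}) = Q n (r w)"
      using ext unfolding Qr by blast
    define K where "K w = distr \<Lambda> (qsigma (prod_qspace UNIV X)) (\<Psi> w)" for w
    have Krv: "K \<in> rvs ?PU"
      using \<Psi> \<Lambda> by (auto simp: prob_qspace_def K_def[abs_def])
    have PU: "quasi_universal ?PU"
      by (intro quasi_universal_prob XU)
    \<comment> \<open>The kernel built over \<Omega> is pulled back along \<open>i\<close>; its
      marginals are right because \<open>r\<close> undoes \<open>i\<close> on
      \<open>points Z\<close>.\<close>
    have "restrict (K \<circ> i) (points Z) \<circ> \<zeta> \<in> rvs ?PU" if "\<zeta> \<in> rvs Z" for \<zeta>
    proof -
      have "i \<circ> \<zeta> \<in> B_Omega \<rightarrow>\<^sub>M B_Omega"
        using i that by (auto simp: quasi_measurable_def Omega_def)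
      then have "K \<circ> (i \<circ> \<zeta>) \<in> rvs ?PU"
        using PU Krv by (auto simp: quasi_universal_def)
      moreover have "restrict (K \<circ> i) (points Z) \<circ> \<zeta> = K \<circ> (i \<circ> \<zeta>)"
        using rvs_in_points[OF assms(3) that] by auto
      ultimately show ?thesis by simp
    qed
    then have "restrict (K \<circ> i) (points Z) \<in> qmaps Z ?PU"
      using rvs_in_points[OF PU Krv] by (auto simp: qmaps_def quasi_measurable_def)
    moreover have "distr (restrict (K \<circ> i) (points Z) z) (qsigma (prod_qspace {0..n} X)) (\<lambda>x. restrict x {0..n}) = Q n z"
      if "z \<in> points Z" for n z
      using marg[of "i z" n] ri[OF that] that by (simp add: K_def)
    ultimately show ?thesis by blast
  qed
  then show ?thesis
  proof (rule ex_ex1I)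
    fix K K'
    assume "K \<in> qmaps Z ?PU \<and> (\<forall>n. \<forall>z\<in>points Z.
        distr (K z) (qsigma (prod_qspace {0..n} X)) (\<lambda>x. restrict x {0..n}) = Q n z)"
      and "K' \<in> qmaps Z ?PU \<and> (\<forall>n. \<forall>z\<in>points Z.
        distr (K' z) (qsigma (prod_qspace {0..n} X)) (\<lambda>x. restrict x {0..n}) = Q n z)"
    then show "K = K'"
      by (intro unique) auto
  qed
qed

end
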